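(* Consider the separable convex problem and the two-stage algorithm described in the context, run with input $\lambda_0=0_m$, constant stepsize $\alpha_t=\alpha=\frac{\Lambda}{\tilde G\sqrt T}$ for some $\Lambda>0$, and Frank-Wolfe stepsizes $\rho_k=\frac{2N}{k+2N}$. Assume that a dual maximizer $\lambda^*\in\mathbb{R}^m_+$ exists and that strong duality holds. Then the output $\hat x^K$ satisfies $$\mathbb{E}\Big[\frac1N\sum_{i=1}^N h_i(\hat x_i^K)-d^*\Big]\le R(T,K),\qquad \mathbb{E}\Big\|\frac1N\sum_{i=1}^N A_i\hat x_i^K-b\Big\|_+\le R(T,K),$$ where $$R(T,K)=\frac{P_1}{\sqrt T}+\frac{P_2}{\sqrt K}+\frac{2N}{K}\Big(P_3\sqrt{\frac{N-1}{T}}+\frac{P_4}{\sqrt T}+P_5\frac NT\Big)$$ and $$P_1=\tilde G\Big(\frac{\|\lambda^*\|^2}{2\Lambda}+\frac{\Lambda}{2}\Big),\quad P_2=2D,\quad P_3=\frac{H+(\|\lambda^*\|+1)\tilde G}{\sqrt2},$$ $$P_4=\tilde G\Big(\frac{\Lambda}{\sqrt2}+\frac{\|\lambda^*\|^2}{2\sqrt2\,\Lambda}+\frac{\|\lambda^*\|+1}{\sqrt2}\Big(1+\frac{2\|\lambda^*\|}{\Lambda}\Big)\Big),\quad P_5=\tilde G\,\frac{3\|\lambda^*\|+1+\Lambda}{\sqrt2}.$$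
   Context: Problem. For $i=1,\dots,N$, $h_i:\mathbb{R}^{d_i}\to\mathbb{R}\cup\{+\infty\}$ is proper, convex, lower semicontinuous with convex compact domain $X_i=\mathrm{dom}(h_i)$; $A_i\in\mathbb{R}^{m\times d_i}$, $b\in\mathbb{R}^m$. The primal problem is to minimize $\frac1N\sum_i h_i(x_i)$ subject to $\frac1N\sum_i A_ix_i\le b$ (componentwise), $x_i\in X_i$. The dual function is $d(\lambda)=-\lambda^\top b+\frac1N\sum_{i=1}^N\inf_{x_i\in X_i}\{h_i(x_i)+\lambda^\top A_ix_i\}$, maximized over $\lambda\in\mathbb{R}^m_+$. Standing assumption: there is $\lambda^*\in\arg\max_{\lambda\in\mathbb{R}^m_+}d(\lambda)$, and $d^*:=d(\lambda^* )$ equals the optimal value of the primal problem (strong duality). Notation. $\|\cdot\|$ is the Euclidean norm, $\|x\|_+=\sqrt{\sum_j\max(x_j,0)^2}$, $\Pi_+(x)_j=\max(x_j,0)$. $\tilde G=\sup_{i,\,x_i\in X_i}\|A_ix_i-b\|$ (assumed positive), $H=\sup_{i,\,x_i\in X_i}|h_i(x_i)|$. $C_i=\{(h_i(x_i),A_ix_i):x_i\in X_i\}\subset\mathbb{R}^{1+m}$ and $D\ge0$ is defined by $D^2=\frac1N\sum_i\mathrm{diam}(\mathrm{conv}(C_i))^2$. $H$ and $D$ are treated as finite constants. Oracle. For $\gamma\ge0$, $\lambda\in\mathbb{R}^m$, $x_i^*((\gamma,\lambda))\in\arg\min_{x_i\in X_i}\{\gamma h_i(x_i)+\lambda^\top A_ix_i\}$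 is a fixed selection; $x_i^*(\lambda)=x_i^*((1,\lambda))$. Stage 1 (stochastic dual subgradient, $T\ge1$ iterations). Start from $\lambda_0$. For $t=0,\dots,T-2$: sample $i_t$ uniformly in $\{1,\dots,N\}$ (independently of the past), set $g_t=A_{i_t}x^*_{i_t}(\lambda_t)-b$ and $\lambda_{t+1}=\Pi_+(\lambda_t+\alpha_tg_t)$. Let $I_i$ be the number of $t\in\{0,\dots,T-2\}$ with $i_t=i$. Last step ($t=T-1$): compute $x_i^*(\lambda_{T-1})$ for all $i$, set $g_{T-1}=\frac1N\sum_iA_ix_i^*(\lambda_{T-1})-b$, $\lambda_T=\Pi_+(\lambda_{T-1}+\alpha_{T-1}g_{T-1})$. Output $\bar\lambda_T=\frac1T\sum_{t=0}^{T-1}\lambda_t$ and $\bar x_{i,T}=\frac1{I_i+1}\big(x_i^*(\lambda_{T-1})+\sum_{t\le T-2,\,i_t=i}x_i^*(\lambda_t)\big)$. Stage 2 (block-coordinate Frank-Wolfe, $K\ge1$ iterations). Set $\hat x_i^0=x_i^0=\bar x_{i,T}$, $\beta_i^0=\frac1Nh_i(x_i^0)$, $z_i^0=\frac1NA_ix_i^0$. For $k=0,\dots,K-1$: with $\beta^k=\sum_i\beta_i^k$, $z^k=\sum_iz_i^k$, set $\gamma^k=\max(\beta^k-d(\bar\lambda_T),0)$, $g^k=\Pi_+(z^k-b)$; sample $i_k$ uniformly in $\{1,\dots,N\}$ independently; compute $x_{i_k}^{k+1}=x^*_{i_k}((\gamma^k,g^k))$; for $i=i_k$ set $(\beta_i^{k+1},z_i^{k+1})=(1-\rho_k)(\beta_i^k,z_i^k)+\frac{\rho_k}{N}(h_i(x_i^{k+1}),A_ix_i^{k+1})$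 and $\hat x_i^{k+1}=(1-\rho_k)\hat x_i^k+\rho_kx_i^{k+1}$; all other blocks are unchanged. Output $\hat x^K$. $\mathbb{E}$ is the expectation over the randomness of both stages. *)

theory Defs
  imports "HOL-Probability.Probability"
begin

text \<open>
  Blocks are indexed by a finite type \<open>'i\<close>, so \<open>N = CARD('i)\<close>. To allow the block dimensions
  \<open>d\<^sub>i\<close> to differ, the \<open>i\<close>-th block space is the coordinate subspace of a common \<open>real^'d\<close>
  spanned by a set \<open>J i\<close> of coordinates, with \<open>d\<^sub>i = card (J i)\<close>; every family of dimensions arises
  this way. Columns of \<open>A i\<close> outside \<open>J i\<close> and values of \<open>h i\<close> outside the subspace play no role.
\<close>

definition coord_space :: "'d set \<Rightarrow> (real^'d) set" where
  "coord_space J = {x. \<forall>j. j \<notin> J \<longrightarrow> x $ j = 0}"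

subsection \<open>Extended-real-valued functions on a set\<close>

definition eff_dom :: "'a set \<Rightarrow> ('a \<Rightarrow> ereal) \<Rightarrow> 'a set" where
  "eff_dom S f = {x \<in> S. f x < \<infinity>}"

definition proper_on :: "'a set \<Rightarrow> ('a \<Rightarrow> ereal) \<Rightarrow> bool" where
  "proper_on S f \<longleftrightarrow> (\<forall>x\<in>S. f x \<noteq> -\<infinity>) \<and> (\<exists>x\<in>S. f x \<noteq> \<infinity>)"

text \<open>Only used for proper functions, where no \<open>\<infinity> - \<infinity>\<close> arises; \<open>0 * \<infinity> = 0\<close> at the endpoints.\<close>

definition ereal_convex_on :: "'a::real_vector set \<Rightarrow> ('a \<Rightarrow> ereal) \<Rightarrow> bool" where
  "ereal_convex_on S f \<longleftrightarrow>
     (\<forall>x\<in>S. \<forall>y\<in>S. \<forall>t\<in>{0..1}.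
        f ((1 - t) *\<^sub>R x + t *\<^sub>R y) \<le> ereal (1 - t) * f x + ereal t * f y)"

definition lsc_on :: "'a::topological_space set \<Rightarrow> ('a \<Rightarrow> ereal) \<Rightarrow> bool" where
  "lsc_on S f \<longleftrightarrow> (\<forall>x\<in>S. f x \<le> Liminf (at x within S) f)"

subsection \<open>Positive parts\<close>

definition pos_part :: "real^'m \<Rightarrow> real^'m" where
  "pos_part x = (\<chi> j. max (x $ j) 0)"

definition plus_norm :: "real^'m \<Rightarrow> real" where
  "plus_norm x = sqrt (\<Sum>j\<in>UNIV. (max (x $ j) 0)\<^sup>2)"

subsection \<open>Primal and dual problems\<close>

text \<open>
  The primal value is taken in \<open>ereal\<close>, so that it is \<open>\<infinity>\<close> for an infeasible problem.
  The order on \<open>real^'m\<close> is componentwise.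
\<close>

definition primal_value ::
  "('i::finite \<Rightarrow> (real^'d) set) \<Rightarrow> ('i \<Rightarrow> real^'d \<Rightarrow> ereal) \<Rightarrow> ('i \<Rightarrow> real^'d^'m) \<Rightarrow> real^'m \<Rightarrow> ereal" where
  "primal_value X h A b =
     (INF x \<in> {x. (\<forall>i. x i \<in> X i) \<and> (1 / real CARD('i)) *\<^sub>R (\<Sum>i\<in>UNIV. A i *v x i) \<le> b}.
        ereal (1 / real CARD('i)) * (\<Sum>i\<in>UNIV. h i (x i)))"

text \<open>
  From here on \<open>f i\<close> stands for the real-valued restriction of \<open>h i\<close> to its domain \<open>X i\<close>. All
  points at which the algorithm evaluates \<open>f i\<close> are convex combinations of points of \<open>X i\<close>. The
  infima below are over nonempty sets; they are bounded below when \<open>f i\<close> and \<open>A i\<close> are bounded on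
  \<open>X i\<close>, as they are in the theorem.
\<close>

definition dual_fun ::
  "('i::finite \<Rightarrow> (real^'d) set) \<Rightarrow> ('i \<Rightarrow> real^'d \<Rightarrow> real) \<Rightarrow> ('i \<Rightarrow> real^'d^'m) \<Rightarrow> real^'m \<Rightarrow> real^'m \<Rightarrow> real" where
  "dual_fun X f A b l =
     - (l \<bullet> b) + (1 / real CARD('i)) * (\<Sum>i\<in>UNIV. INF x\<in>X i. f i x + l \<bullet> (A i *v x))"

text \<open>Linear minimization oracle: \<open>xs i \<gamma> l\<close> is the selected minimizer for the pair \<open>(\<gamma>, l)\<close>.\<close>

definition is_oracle ::
  "('i \<Rightarrow> (real^'d) set) \<Rightarrow> ('i \<Rightarrow> real^'d \<Rightarrow> real) \<Rightarrow> ('i \<Rightarrow> real^'d^'m) \<Rightarrow>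
   ('i \<Rightarrow> real \<Rightarrow> real^'m \<Rightarrow> real^'d) \<Rightarrow> bool" where
  "is_oracle X f A xs \<longleftrightarrow>
     (\<forall>i \<gamma> l. 0 \<le> \<gamma> \<longrightarrow>
        is_arg_min (\<lambda>x. \<gamma> * f i x + l \<bullet> (A i *v x)) (\<lambda>x. x \<in> X i) (xs i \<gamma> l))"

subsection \<open>Problem constants\<close>

definition G_const :: "('i \<Rightarrow> (real^'d) set) \<Rightarrow> ('i \<Rightarrow> real^'d^'m) \<Rightarrow> real^'m \<Rightarrow> real" where
  "G_const X A b = Sup {norm (A i *v x - b) | i x. x \<in> X i}"

definition H_const :: "('i \<Rightarrow> (real^'d) set) \<Rightarrow> ('i \<Rightarrow> real^'d \<Rightarrow> real) \<Rightarrow> real" where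
  "H_const X f = Sup {\<bar>f i x\<bar> | i x. x \<in> X i}"

text \<open>The product type carries the Euclidean norm of \<open>\<real>\<^bsup>1+m\<^esup>\<close>.\<close>

definition C_set ::
  "('i \<Rightarrow> (real^'d) set) \<Rightarrow> ('i \<Rightarrow> real^'d \<Rightarrow> real) \<Rightarrow> ('i \<Rightarrow> real^'d^'m) \<Rightarrow> 'i \<Rightarrow> (real \<times> (real^'m)) set" where
  "C_set X f A i = (\<lambda>x. (f i x, A i *v x)) ` X i"

definition D_const ::
  "('i::finite \<Rightarrow> (real^'d) set) \<Rightarrow> ('i \<Rightarrow> real^'d \<Rightarrow> real) \<Rightarrow> ('i \<Rightarrow> real^'d^'m) \<Rightarrow> real" where
  "D_const X f A =
     sqrt ((1 / real CARD('i)) * (\<Sum>i\<in>UNIV. (diameter (convex hull (C_set X f A i)))\<^sup>2))"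

subsection \<open>Stage 1: stochastic dual subgradient\<close>

text \<open>
  Both stages are defined pathwise, for given index sequences \<open>s\<close> (stage 1) and \<open>r\<close> (stage 2).
  \<open>dual_iter \<dots> t\<close> is \<open>\<lambda>\<^sub>t\<close> for \<open>t \<le> T - 1\<close>; the final full step producing \<open>\<lambda>\<^sub>T\<close> does
  not enter the outputs of stage 1 and is left out.
\<close>

primrec dual_iter ::
  "('i \<Rightarrow> real^'d^'m) \<Rightarrow> real^'m \<Rightarrow> ('i \<Rightarrow> real \<Rightarrow> real^'m \<Rightarrow> real^'d) \<Rightarrow>
   real^'m \<Rightarrow> (nat \<Rightarrow> real) \<Rightarrow> (nat \<Rightarrow> 'i) \<Rightarrow> nat \<Rightarrow> real^'m" where
  "dual_iter A b xs l0 \<alpha> s 0 = l0"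
| "dual_iter A b xs l0 \<alpha> s (Suc t) =
     (let l = dual_iter A b xs l0 \<alpha> s t
      in pos_part (l + \<alpha> t *\<^sub>R (A (s t) *v xs (s t) 1 l - b)))"

definition dual_avg ::
  "('i \<Rightarrow> real^'d^'m) \<Rightarrow> real^'m \<Rightarrow> ('i \<Rightarrow> real \<Rightarrow> real^'m \<Rightarrow> real^'d) \<Rightarrow>
   real^'m \<Rightarrow> (nat \<Rightarrow> real) \<Rightarrow> nat \<Rightarrow> (nat \<Rightarrow> 'i) \<Rightarrow> real^'m" where
  "dual_avg A b xs l0 \<alpha> T s = (1 / real T) *\<^sub>R (\<Sum>t<T. dual_iter A b xs l0 \<alpha> s t)"

definition primal_avg ::
  "('i \<Rightarrow> real^'d^'m) \<Rightarrow> real^'m \<Rightarrow> ('i \<Rightarrow> real \<Rightarrow> real^'m \<Rightarrow> real^'d) \<Rightarrow>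
   real^'m \<Rightarrow> (nat \<Rightarrow> real) \<Rightarrow> nat \<Rightarrow> (nat \<Rightarrow> 'i) \<Rightarrow> 'i \<Rightarrow> real^'d" where
  "primal_avg A b xs l0 \<alpha> T s i =
     (let S = {t. t < T - 1 \<and> s t = i}
      in (1 / (real (card S) + 1)) *\<^sub>R
           (xs i 1 (dual_iter A b xs l0 \<alpha> s (T - 1))
            + (\<Sum>t\<in>S. xs i 1 (dual_iter A b xs l0 \<alpha> s t))))"

subsection \<open>Stage 2: block-coordinate Frank-Wolfe\<close>

text \<open>
  A state is \<open>(\<beta>, z, x)\<close>, the families of \<open>\<beta>\<^sub>i\<^sup>k\<close>, \<open>z\<^sub>i\<^sup>k\<close> and of the output
  blocks. The parameter \<open>dv\<close> is the dual value at the averaged dual point of stage 1.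
\<close>

type_synonym ('i, 'd, 'm) fw_state = "('i \<Rightarrow> real) \<times> ('i \<Rightarrow> real^'m) \<times> ('i \<Rightarrow> real^'d)"

definition fw_init ::
  "('i::finite \<Rightarrow> real^'d \<Rightarrow> real) \<Rightarrow> ('i \<Rightarrow> real^'d^'m) \<Rightarrow> ('i \<Rightarrow> real^'d) \<Rightarrow> ('i, 'd, 'm) fw_state" where
  "fw_init f A x0 =
     (\<lambda>i. (1 / real CARD('i)) * f i (x0 i), \<lambda>i. (1 / real CARD('i)) *\<^sub>R (A i *v x0 i), x0)"

definition fw_step ::
  "('i::finite \<Rightarrow> real^'d \<Rightarrow> real) \<Rightarrow> ('i \<Rightarrow> real^'d^'m) \<Rightarrow> real^'m \<Rightarrow>
   ('i \<Rightarrow> real \<Rightarrow> real^'m \<Rightarrow> real^'d) \<Rightarrow> real \<Rightarrow> real \<Rightarrow> 'i \<Rightarrow>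
   ('i, 'd, 'm) fw_state \<Rightarrow> ('i, 'd, 'm) fw_state" where
  "fw_step f A b xs dv \<rho> i = (\<lambda>(\<beta>, z, x).
     let \<gamma> = max ((\<Sum>j\<in>UNIV. \<beta> j) - dv) 0;
         g = pos_part ((\<Sum>j\<in>UNIV. z j) - b);
         y = xs i \<gamma> g
     in (\<beta>(i := (1 - \<rho>) * \<beta> i + (\<rho> / real CARD('i)) * f i y),
         z(i := (1 - \<rho>) *\<^sub>R z i + (\<rho> / real CARD('i)) *\<^sub>R (A i *v y)),
         x(i := (1 - \<rho>) *\<^sub>R x i + \<rho> *\<^sub>R y)))"

primrec fw_iter ::
  "('i::finite \<Rightarrow> real^'d \<Rightarrow> real) \<Rightarrow> ('i \<Rightarrow> real^'d^'m) \<Rightarrow> real^'m \<Rightarrow>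
   ('i \<Rightarrow> real \<Rightarrow> real^'m \<Rightarrow> real^'d) \<Rightarrow> real \<Rightarrow> (nat \<Rightarrow> real) \<Rightarrow> ('i \<Rightarrow> real^'d) \<Rightarrow>
   (nat \<Rightarrow> 'i) \<Rightarrow> nat \<Rightarrow> ('i, 'd, 'm) fw_state" where
  "fw_iter f A b xs dv \<rho> x0 r 0 = fw_init f A x0"
| "fw_iter f A b xs dv \<rho> x0 r (Suc k) =
     fw_step f A b xs dv (\<rho> k) (r k) (fw_iter f A b xs dv \<rho> x0 r k)"

subsection \<open>The two-stage algorithm\<close>

definition two_stage_output ::
  "('i::finite \<Rightarrow> (real^'d) set) \<Rightarrow> ('i \<Rightarrow> real^'d \<Rightarrow> real) \<Rightarrow> ('i \<Rightarrow> real^'d^'m) \<Rightarrow> real^'m \<Rightarrow>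
   ('i \<Rightarrow> real \<Rightarrow> real^'m \<Rightarrow> real^'d) \<Rightarrow> real^'m \<Rightarrow> (nat \<Rightarrow> real) \<Rightarrow> (nat \<Rightarrow> real) \<Rightarrow>
   nat \<Rightarrow> nat \<Rightarrow> (nat \<Rightarrow> 'i) \<times> (nat \<Rightarrow> 'i) \<Rightarrow> 'i \<Rightarrow> real^'d" where
  "two_stage_output X f A b xs l0 \<alpha> \<rho> T K = (\<lambda>(s, r).
     snd (snd (fw_iter f A b xs
       (dual_fun X f A b (dual_avg A b xs l0 \<alpha> T s)) \<rho> (primal_avg A b xs l0 \<alpha> T s) r K)))"

text \<open>
  Joint law of the \<open>T - 1\<close> indices sampled in stage 1 and the \<open>K\<close> indices sampled in stage 2:
  all independent and uniform on the blocks.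
\<close>

definition samples :: "nat \<Rightarrow> nat \<Rightarrow> ((nat \<Rightarrow> 'i::finite) \<times> (nat \<Rightarrow> 'i)) pmf" where
  "samples T K =
     pair_pmf (Pi_pmf {..<T - 1} undefined (\<lambda>_. pmf_of_set UNIV))
              (Pi_pmf {..<K} undefined (\<lambda>_. pmf_of_set UNIV))"

subsection \<open>The bound\<close>

text \<open>Arguments: \<open>N\<close>, the constants \<open>G\<close>, \<open>H\<close>, \<open>D\<close>, the stepsize parameter \<open>L\<close>, and
  \<open>n\<close>, the norm of the dual maximizer.\<close>

definition rate ::
  "nat \<Rightarrow> real \<Rightarrow> real \<Rightarrow> real \<Rightarrow> real \<Rightarrow> real \<Rightarrow> nat \<Rightarrow> nat \<Rightarrow> real" where
  "rate N G H D L n T K =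
     (let P1 = G * (n\<^sup>2 / (2 * L) + L / 2);
          P2 = 2 * D;
          P3 = (H + (n + 1) * G) / sqrt 2;
          P4 = G * (L / sqrt 2 + n\<^sup>2 / (2 * sqrt 2 * L) + (n + 1) / sqrt 2 * (1 + 2 * n / L));
          P5 = G * ((3 * n + 1 + L) / sqrt 2)
      in P1 / sqrt (real T) + P2 / sqrt (real K)
         + 2 * real N / real K *
           (P3 * sqrt ((real N - 1) / real T) + P4 / sqrt (real T) + P5 * (real N / real T)))"

end

theory Submission
  imports Defs
begin

text \<open>
  Let \<open>p\<close> be the dual gap of the point returned by stage 1, and let \<open>\<Phi>\<close> be the sum of the squares of
  \<open>max (\<beta> - dv) 0\<close> and of the norm of the positive part of \<open>z - b\<close>, the function minimized by stage 2.
  As \<open>\<Phi>\<close> is essentially a squared distance, pairing its gradient with the direction to a primal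
  solution controls all of \<open>\<Phi>\<close> up to a term linear in \<open>p\<close>. Hence the excess of
  \<open>sqrt (E \<Phi>)\<close> over \<open>p\<close> contracts by \<open>1 - 2 / (k + 2 N)\<close> in step \<open>k\<close>, and the excess at the
  start of stage 2 is damped by a factor of at most \<open>N / (2 K)\<close>.

  Stage 1 bounds the expectations of \<open>p\<close> and of that initial excess. The distance of the dual
  iterates to \<open>\<lambda>\<^sup>*\<close>, their norm together with the objective values seen, and the squared deviation of
  the number of visits to a block are supermartingales up to a drift. The visit counts enter because
  the blockwise averages are weighted by them instead of by \<open>T / N\<close>; if \<open>T < N\<close>, the trivial bound
  on the initial excess is good enough.
\<close>

subsection \<open>Finitely supported expectations and adaptive sampling\<close>

text \<open>When \<open>p > 0\<close>, stage 2 cannot reach merit 0: its target \<open>dv\<close>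
  lies \<open>p\<close> below the optimal value, and a primal solution has merit \<open>p^2\<close>.
  Working with the excess over \<open>p\<close> lets \<open>p\<close> enter the final bound with
  coefficient one. The recursion closes in the second moment because its only term linear in the
  state, \<open>a * p\<close>, is controlled by the root of the expected merit through Jensen's
  inequality.

  Stage 1 controls suboptimality only as a signed quantity, whereas the excess contains a positive
  part, which does not commute with expectation. Weak duality removes it: suboptimality plus
  \<open>norm ls\<close> times infeasibility is nonnegative. This is the origin of the factors
  \<open>norm ls + 1\<close>.

  The damping \<open>N / (2 K)\<close> is a quarter of the factor \<open>2 N / K\<close> in the
  claim. Together with the \<open>sqrt 2\<close> in the denominators of P3, P4 and P5 this leaves an
  allowance of \<open>2 * sqrt 2\<close> for the expected initial excess. It pays for the surplus
  evaluations of the last full pass of stage 1 and for the constant \<open>sqrt 2\<close> in the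
  bound on the visit counts.\<close>

lemma expectation_mono_finite:
  fixes F G :: "'a \<Rightarrow> real"
  assumes "finite (set_pmf p)" "\<And>x. x \<in> set_pmf p \<Longrightarrow> F x \<le> G x"
  shows "measure_pmf.expectation p F \<le> measure_pmf.expectation p G"
  using assms by (intro integral_mono_AE integrable_measure_pmf_finite) (auto simp: AE_measure_pmf_iff)

lemma expectation_square_le:
  fixes F :: "'a \<Rightarrow> real"
  assumes "finite (set_pmf p)"
  shows "(measure_pmf.expectation p F)\<^sup>2 \<le> measure_pmf.expectation p (\<lambda>x. (F x)\<^sup>2)"
proof -
  have "measure_pmf.variance p F
      = measure_pmf.expectation p (\<lambda>x. (F x)\<^sup>2) - (measure_pmf.expectation p F)\<^sup>2"
    by (intro measure_pmf.variance_eq integrable_measure_pmf_finite assms)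
  then show ?thesis
    using measure_pmf.variance_positive[of p F] by linarith
qed

lemma expectation_le_sqrt:
  fixes F :: "'a \<Rightarrow> real"
  assumes "finite (set_pmf p)" "measure_pmf.expectation p (\<lambda>x. (F x)\<^sup>2) \<le> c"
  shows "measure_pmf.expectation p F \<le> sqrt c"
  using expectation_square_le[OF assms(1), of F] assms(2) by (intro real_le_rsqrt) simp

lemma expectation_pair_pmf_finite:
  fixes F :: "'a \<times> 'b \<Rightarrow> real"
  assumes "finite (set_pmf p)" "finite (set_pmf q)"
  shows "measure_pmf.expectation (pair_pmf p q) F
      = measure_pmf.expectation p (\<lambda>x. measure_pmf.expectation q (\<lambda>y. F (x, y)))"
proof -
  have "measure_pmf.expectation (pair_pmf p q) F
      = (\<Sum>z\<in>set_pmf p \<times> set_pmf q. pmf (pair_pmf p q) z *\<^sub>R F z)"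
    using assms by (intro integral_measure_pmf) auto
  also have "\<dots> = (\<Sum>x\<in>set_pmf p. \<Sum>y\<in>set_pmf q. pmf p x * pmf q y * F (x, y))"
    by (auto simp: sum.cartesian_product pmf_pair intro!: sum.cong)
  also have "\<dots> = (\<Sum>x\<in>set_pmf p. pmf p x *\<^sub>R (\<Sum>y\<in>set_pmf q. pmf q y *\<^sub>R F (x, y)))"
    by (simp add: sum_distrib_left mult.assoc)
  also have "\<dots> = (\<Sum>x\<in>set_pmf p. pmf p x *\<^sub>R measure_pmf.expectation q (\<lambda>y. F (x, y)))"
    using assms(2) by (intro sum.cong refl arg_cong2[where f = "(*\<^sub>R)"] integral_measure_pmf[symmetric]) auto
  also have "\<dots> = measure_pmf.expectation p (\<lambda>x. measure_pmf.expectation q (\<lambda>y. F (x, y)))"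
    using assms(1) by (intro integral_measure_pmf[symmetric]) auto
  finally show ?thesis .
qed

text \<open>Either factor of the law \<open>samples\<close>. Coordinates from \<open>n\<close> on
  are frozen at \<open>undefined\<close>, so the sequences for \<open>n\<close> and
  \<open>Suc n\<close> live in the same type and differ by one function update.\<close>

definition unif_seq :: "nat \<Rightarrow> (nat \<Rightarrow> 'i::finite) pmf" where
  "unif_seq n = Pi_pmf {..<n} undefined (\<lambda>_. pmf_of_set UNIV)"

lemma finite_set_unif_seq [simp]: "finite (set_pmf (unif_seq n :: (nat \<Rightarrow> 'i::finite) pmf))"
  unfolding unif_seq_def
  by (rule finite_subset[OF set_Pi_pmf_subset']) (auto intro!: finite_PiE_dflt)

lemma integrable_unif_seq [simp]:
  "integrable (measure_pmf (unif_seq n)) (F :: (nat \<Rightarrow> 'i::finite) \<Rightarrow> real)"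
  by (rule integrable_measure_pmf_finite) simp

lemma expectation_unif_seq_0:
  "measure_pmf.expectation (unif_seq 0) (F :: (nat \<Rightarrow> 'i::finite) \<Rightarrow> real) = F (\<lambda>_. undefined)"
  by (simp add: unif_seq_def)

text \<open>The tower property: the last index is independent of the earlier ones, so it can be
  averaged out first. A process enters as a function of the whole index sequence, which takes the
  place of a filtration.\<close>

lemma expectation_unif_seq_Suc:
  fixes F :: "(nat \<Rightarrow> 'i::finite) \<Rightarrow> real"
  shows "measure_pmf.expectation (unif_seq (Suc n)) F
      = measure_pmf.expectation (unif_seq n) (\<lambda>s. (\<Sum>i\<in>UNIV. F (s(n := i))) / real CARD('i))"
proof -
  have "measure_pmf.expectation (unif_seq (Suc n)) F
      = measure_pmf.expectation (pair_pmf (unif_seq n) (pmf_of_set UNIV)) (\<lambda>(s, i). F (s(n := i)))"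
    unfolding unif_seq_def lessThan_Suc
    by (subst Pi_pmf_insert, simp, simp, subst pair_commute_pmf)
      (simp add: split_beta)
  also have "\<dots> = measure_pmf.expectation (unif_seq n)
      (\<lambda>s. measure_pmf.expectation (pmf_of_set UNIV) (\<lambda>i. F (s(n := i))))"
    by (subst expectation_pair_pmf_finite) auto
  also have "\<dots> = measure_pmf.expectation (unif_seq n) (\<lambda>s. (\<Sum>i\<in>UNIV. F (s(n := i))) / real CARD('i))"
    by (subst integral_pmf_of_set) auto
  finally show ?thesis .
qed

text \<open>A supermartingale with constant drift, in pathwise form. \<open>V n\<close> may depend
  on the entire past, so potentials that carry running sums are covered. The initial value is taken
  at the only sequence in the support for length 0.\<close>

lemma expectation_unif_seq_drift:
  fixes V :: "nat \<Rightarrow> (nat \<Rightarrow> 'i::finite) \<Rightarrow> real"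
  assumes "\<And>n s. (\<Sum>i\<in>UNIV. V (Suc n) (s(n := i))) / real CARD('i) \<le> V n s + c"
  shows "measure_pmf.expectation (unif_seq n) (V n) \<le> V 0 (\<lambda>_. undefined) + real n * c"
proof (induction n)
  case (Suc n)
  have "measure_pmf.expectation (unif_seq (Suc n)) (V (Suc n))
      \<le> measure_pmf.expectation (unif_seq n) (\<lambda>s. V n s + c)"
    unfolding expectation_unif_seq_Suc by (intro expectation_mono_finite assms) simp
  also have "\<dots> = measure_pmf.expectation (unif_seq n) (V n) + c" by simp
  finally show ?case using Suc by (simp add: algebra_simps)
qed (simp add: expectation_unif_seq_0)

subsection \<open>Positive parts\<close>

lemma plus_norm_eq: "plus_norm x = norm (pos_part x)"
  by (simp add: plus_norm_def pos_part_def norm_vec_def L2_set_def)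

lemma plus_norm_nonneg: "0 \<le> plus_norm x"
  by (simp add: plus_norm_eq)

lemma plus_norm_le_norm:
  assumes "x \<le> y"
  shows "plus_norm x \<le> norm y"
  unfolding plus_norm_eq using assms
  by (intro norm_le_componentwise_cart)
    (auto simp: pos_part_def less_eq_vec_def abs_real_def intro: order.trans)

lemma inner_pos_part_self: "pos_part x \<bullet> x = (plus_norm x)\<^sup>2"
  by (simp add: plus_norm_def pos_part_def inner_vec_def sum_nonneg power2_eq_square max_def
      cong: sum.cong) (auto intro!: sum.cong)

lemma pos_part_nonneg: "0 \<le> pos_part x"
  by (simp add: pos_part_def less_eq_vec_def)

lemma le_pos_part: "x \<le> pos_part x"
  by (simp add: pos_part_def less_eq_vec_def)

lemma inner_nonneg_vec:
  fixes x y :: "real^'m"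
  assumes "0 \<le> x" "0 \<le> y"
  shows "0 \<le> x \<bullet> y"
  using assms by (auto simp: inner_vec_def less_eq_vec_def intro!: sum_nonneg)

text \<open>A nonnegative multiplier can only gain from the violated constraints, so Cauchy-Schwarz
  is applied after discarding the negative coordinates of \<open>x\<close>.\<close>

lemma inner_le_plus_norm:
  fixes l x :: "real^'m"
  assumes "0 \<le> l"
  shows "l \<bullet> x \<le> norm l * plus_norm x"
proof -
  have "0 \<le> l \<bullet> (pos_part x - x)"
    using le_pos_part[of x] assms by (intro inner_nonneg_vec) auto
  then have "l \<bullet> x \<le> l \<bullet> pos_part x" by (simp add: inner_diff_right)
  also have "\<dots> \<le> norm l * plus_norm x"
    unfolding plus_norm_eq by (rule norm_cauchy_schwarz)
  finally show ?thesis .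
qed

text \<open>Projection onto the orthant is nonexpansive and fixes \<open>l\<close>; for an orthant
  this holds coordinate by coordinate.\<close>

lemma norm_pos_part_diff_le:
  fixes x l :: "real^'m"
  assumes "0 \<le> l"
  shows "norm (pos_part x - l) \<le> norm (x - l)"
proof (intro norm_le_componentwise_cart)
  fix j
  show "norm ((pos_part x - l) $ j) \<le> norm ((x - l) $ j)"
    using assms[unfolded less_eq_vec_def, rule_format, of j] by (simp add: pos_part_def)
qed

text \<open>The quadratic upper bound for the smooth function \<open>(max x 0)^2\<close>, whose
  derivative \<open>2 * max x 0\<close> is 2-Lipschitz. It reduces to
  \<open>max (x + y) 0 \<le> \<bar>max x 0 + y\<bar>\<close>.\<close>

lemma max0_add_square_le:
  fixes x y :: real
  shows "(max (x + y) 0)\<^sup>2 \<le> (max x 0)\<^sup>2 + 2 * max x 0 * y + y\<^sup>2"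
proof -
  have "(max (x + y) 0)\<^sup>2 \<le> (max x 0 + y)\<^sup>2"
    by (rule abs_le_square_iff[THEN iffD1]) (auto simp: max_def abs_real_def)
  then show ?thesis by (simp add: power2_sum algebra_simps)
qed

lemma plus_norm_add_square_le:
  fixes x y :: "real^'m"
  shows "(plus_norm (x + y))\<^sup>2 \<le> (plus_norm x)\<^sup>2 + 2 * (pos_part x \<bullet> y) + (norm y)\<^sup>2"
proof -
  have "(plus_norm (x + y))\<^sup>2 \<le> (\<Sum>j\<in>UNIV. (max (x $ j) 0)\<^sup>2 + 2 * max (x $ j) 0 * y $ j + (y $ j)\<^sup>2)"
    by (simp add: plus_norm_def sum_nonneg max0_add_square_le sum_mono)
  also have "\<dots> = (plus_norm x)\<^sup>2 + 2 * (pos_part x \<bullet> y) + (norm y)\<^sup>2"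
    by (simp add: plus_norm_def pos_part_def inner_vec_def norm_vec_def L2_set_def sum_nonneg
        sum.distrib sum_distrib_left mult.assoc)
  finally show ?thesis .
qed

subsection \<open>A scalar recursion\<close>

text \<open>For \<open>u = p + e\<close> with \<open>e \<ge> 0\<close>, completing the square gives
  \<open>u^2 - 2 * c * u * e = (p + (1 - c) * e)^2 - (c * e)^2\<close>, so the excess itself shrinks
  by \<open>1 - c\<close>. The noise \<open>y^2\<close> then has to be added to the square of the
  excess and not to that of \<open>p + w\<close>.\<close>

lemma sqrt_recursion_step:
  fixes u v p c y :: real
  assumes "0 \<le> u" "0 \<le> v" "0 \<le> p" "0 \<le> c" "c \<le> 1"
    and v: "v\<^sup>2 \<le> u\<^sup>2 - 2 * c * u * (u - p) + y\<^sup>2"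
  shows "(max (v - p) 0)\<^sup>2 \<le> (1 - c)\<^sup>2 * (max (u - p) 0)\<^sup>2 + y\<^sup>2"
proof -
  define e where "e = max (u - p) 0"
  define w where "w = (1 - c) * e"
  have e: "0 \<le> e" and w: "0 \<le> w" using assms by (auto simp: e_def w_def)
  have "u\<^sup>2 - 2 * c * u * (u - p) \<le> (p + w)\<^sup>2"
  proof (cases "p \<le> u")
    case True
    then have u: "u = p + e" by (simp add: e_def)
    have "(p + w)\<^sup>2 - (u\<^sup>2 - 2 * c * u * (u - p)) = (c * e)\<^sup>2"
      unfolding w_def u by (simp add: power2_eq_square algebra_simps)
    then show ?thesis by (smt (verit) zero_le_power2)
  next
    case False
    \<comment> \<open>Below \<open>p\<close> the middle term pushes upwards, but both members of
      this convex combination stay below \<open>p^2\<close>, so no excess is created.\<close>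
    have "u\<^sup>2 - 2 * c * u * (u - p) = (1 - c) * u\<^sup>2 + c * (u * (2 * p - u))"
      by (simp add: power2_eq_square algebra_simps)
    also have "\<dots> \<le> (1 - c) * p\<^sup>2 + c * p\<^sup>2"
    proof (intro add_mono mult_left_mono power_mono)
      show "u * (2 * p - u) \<le> p\<^sup>2"
        using zero_le_power2[of "u - p"] by (simp add: power2_eq_square algebra_simps)
    qed (use assms False in auto)
    also have "\<dots> = p\<^sup>2" by (simp add: algebra_simps)
    also have "\<dots> \<le> (p + w)\<^sup>2" using assms w by (intro power_mono) auto
    finally show ?thesis .
  qed
  then have vv: "v\<^sup>2 \<le> (p + w)\<^sup>2 + y\<^sup>2" using v by linarith
  \<comment> \<open>Moving \<open>p\<close> out of the root only enlarges the cross term, from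
    \<open>2 * p * w\<close> to \<open>2 * p * sqrt (w^2 + y^2)\<close>.\<close>
  have "v \<le> p + sqrt (w\<^sup>2 + y\<^sup>2)"
  proof (rule power2_le_imp_le)
    have "w \<le> sqrt (w\<^sup>2 + y\<^sup>2)" by (rule real_le_rsqrt) simp
    then have "p * w \<le> p * sqrt (w\<^sup>2 + y\<^sup>2)" using assms by (intro mult_left_mono)
    moreover have "(p + sqrt (w\<^sup>2 + y\<^sup>2))\<^sup>2 = p\<^sup>2 + 2 * (p * sqrt (w\<^sup>2 + y\<^sup>2)) + (w\<^sup>2 + y\<^sup>2)"
      by (simp add: power2_sum)
    ultimately show "v\<^sup>2 \<le> (p + sqrt (w\<^sup>2 + y\<^sup>2))\<^sup>2"
      using vv by (simp add: power2_sum)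
  qed (use assms in simp)
  then have "max (v - p) 0 \<le> sqrt (w\<^sup>2 + y\<^sup>2)" by auto
  then have "(max (v - p) 0)\<^sup>2 \<le> (sqrt (w\<^sup>2 + y\<^sup>2))\<^sup>2" by (intro power_mono) auto
  then show ?thesis by (simp add: w_def e_def power_mult_distrib)
qed

text \<open>The weights \<open>c k = (k + 2 N - 1) * (k + 2 N - 2)\<close> satisfy
  \<open>c (Suc k) * (1 - 2 / (k + 2 N)) = c k\<close>, so \<open>(c k)^2 * E k\<close> grows only
  by the noise. Each noise term is at most \<open>4 * D^2 * M^2\<close>, where
  \<open>M = K + 2 N - 2\<close> is the value of \<open>m - 1\<close> in the last step.\<close>

lemma fw_recursion:
  fixes E :: "nat \<Rightarrow> real" and D :: real and N K :: nat
  assumes "N \<ge> 1" "K \<ge> 1" "D \<ge> 0" "\<And>k. 0 \<le> E k"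
    and step: "\<And>k. k < K \<Longrightarrow> E (Suc k)
        \<le> (1 - 2 / (real k + 2 * real N))\<^sup>2 * E k + (2 * D / (real k + 2 * real N))\<^sup>2"
  shows "sqrt (E K) \<le> real N / (2 * real K) * sqrt (E 0) + 2 * D / sqrt (real K)"
proof -
  define c where "c k = (real k + 2 * real N - 1) * (real k + 2 * real N - 2)" for k
  define M where "M = real K + 2 * real N - 2"
  have M: "M > 0" "real K \<ge> 1" using assms(1,2) by (auto simp: M_def)
  have main: "(c k)\<^sup>2 * E k \<le> (c 0)\<^sup>2 * E 0 + 4 * D\<^sup>2 * M\<^sup>2 * k" if "k \<le> K" for k
    using that
  proof (induction k)
    case (Suc k)
    define m where "m = real k + 2 * real N"
    have m: "m \<ge> 2" using assms(1) by (simp add: m_def)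
    have cS: "c (Suc k) = m * (m - 1)" and ck: "c k = (m - 1) * (m - 2)"
      by (simp_all add: c_def m_def algebra_simps)
    have "(c (Suc k))\<^sup>2 * E (Suc k) \<le> (c (Suc k))\<^sup>2 * ((1 - 2 / m)\<^sup>2 * E k + (2 * D / m)\<^sup>2)"
      using step[of k] Suc.prems by (intro mult_left_mono) (auto simp: m_def)
    also have "\<dots> = (c k)\<^sup>2 * E k + 4 * D\<^sup>2 * (m - 1)\<^sup>2"
    proof -
      have 1: "c (Suc k) * (1 - 2 / m) = c k" "c (Suc k) * (2 * D / m) = 2 * D * (m - 1)"
        unfolding cS ck using m by (simp_all add: field_simps)
      have "(c (Suc k))\<^sup>2 * ((1 - 2 / m)\<^sup>2 * E k + (2 * D / m)\<^sup>2)
          = (c (Suc k) * (1 - 2 / m))\<^sup>2 * E k + (c (Suc k) * (2 * D / m))\<^sup>2"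
        unfolding power_mult_distrib by (simp add: algebra_simps)
      also have "\<dots> = (c k)\<^sup>2 * E k + 4 * D\<^sup>2 * (m - 1)\<^sup>2"
        unfolding 1 by (simp add: power_mult_distrib)
      finally show ?thesis .
    qed
    also have "4 * D\<^sup>2 * (m - 1)\<^sup>2 \<le> 4 * D\<^sup>2 * M\<^sup>2"
      using Suc.prems m by (intro mult_left_mono power_mono) (auto simp: M_def m_def)
    also have "(c k)\<^sup>2 * E k \<le> (c 0)\<^sup>2 * E 0 + 4 * D\<^sup>2 * M\<^sup>2 * k" using Suc by simp
    finally show ?case by (simp add: algebra_simps)
  qed simp
  have cK: "c K = (M + 1) * M" by (simp add: c_def M_def algebra_simps)
  have cpos: "c K > 0" using M by (simp add: cK)
  have c0: "0 \<le> c 0" using assms(1) by (auto simp: c_def)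
  have "(c K * sqrt (E K))\<^sup>2 \<le> (c 0 * sqrt (E 0) + 2 * D * M * sqrt K)\<^sup>2"
  proof -
    have "(c K * sqrt (E K))\<^sup>2 = (c K)\<^sup>2 * E K" by (simp add: power_mult_distrib assms(4))
    also have "\<dots> \<le> (c 0)\<^sup>2 * E 0 + 4 * D\<^sup>2 * M\<^sup>2 * K" using main by simp
    also have "\<dots> = (c 0 * sqrt (E 0))\<^sup>2 + (2 * D * M * sqrt K)\<^sup>2"
      by (simp add: power_mult_distrib assms(4))
    also have "\<dots> \<le> (c 0 * sqrt (E 0) + 2 * D * M * sqrt K)\<^sup>2"
      using c0 M assms(3,4) by (simp add: power2_sum)
    finally show ?thesis .
  qed
  then have "c K * sqrt (E K) \<le> c 0 * sqrt (E 0) + 2 * D * M * sqrt K"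
    by (rule power2_le_imp_le) (use c0 M assms(3,4) in auto)
  also have "\<dots> \<le> c K * (real N / (2 * K)) * sqrt (E 0) + c K * (2 * D / sqrt K)"
  proof (intro add_mono mult_right_mono)
    define y where "y = 2 * real N - 2"
    have y: "0 \<le> y" using assms(1) by (simp add: y_def)
    have "2 * (real K * c 0) = (2 * real N - 1) * (2 * K * y)"
      by (simp add: c_def y_def algebra_simps)
    also have "\<dots> \<le> (2 * real N - 1) * (M * M / 2)"
    proof (intro mult_left_mono)
      \<comment> \<open>The arithmetic-geometric mean inequality for \<open>M = K + y\<close>. It
        turns \<open>c 0 / c K\<close>, which decays quadratically in \<open>K\<close>, into the
        bound \<open>N / (2 K)\<close> valid for all \<open>K\<close>.\<close>
      show "2 * K * y \<le> M * M / 2"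
        using zero_le_power2[of "real K - y"] unfolding M_def y_def
        by (simp add: power2_eq_square algebra_simps)
    qed (use assms(1) in simp)
    also have "\<dots> \<le> (2 * real N) * ((M + 1) * M / 2)"
      using M assms(1) by (intro mult_mono) auto
    also have "\<dots> = c K * N" by (simp add: cK algebra_simps)
    finally show "c 0 \<le> c K * (real N / (2 * K))" using M by (simp add: field_simps)
    have "M * K \<le> c K" unfolding cK using M assms(1) by (simp add: mult.commute M_def)
    then have "2 * D * (M * K) \<le> 2 * D * c K" using assms(3) by (intro mult_left_mono) auto
    then show "2 * D * M * sqrt K \<le> c K * (2 * D / sqrt K)"
      using M by (simp add: field_simps)
  qed (use assms(4) in simp)
  also have "\<dots> = c K * (real N / (2 * K) * sqrt (E 0) + 2 * D / sqrt K)" by (simp add: algebra_simps)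
  finally show ?thesis using cpos by simp
qed

subsection \<open>The problem with real-valued objectives\<close>

lemma sum_fun_upd:
  fixes v :: "'i::finite \<Rightarrow> 'a::ab_group_add"
  shows "(\<Sum>j\<in>UNIV. (v(i := y)) j) = (\<Sum>j\<in>UNIV. v j) + (y - v i)"
proof -
  have "(\<Sum>j\<in>UNIV - {i}. (v(i := y)) j) = (\<Sum>j\<in>UNIV - {i}. v j)" by (intro sum.cong) auto
  then show ?thesis
    using sum.remove[of UNIV i "v(i := y)"] sum.remove[of UNIV i v] by (simp del: fun_upd_apply) simp
qed

text \<open>The real-valued core of the problem. \<open>H\<close> and \<open>G\<close> enter as
  upper bounds on the block data, and strong duality enters as the existence of feasible points with
  value arbitrarily close to the dual optimum.\<close>

locale dual_decomposition =
  fixes X :: "'i::finite \<Rightarrow> (real^'d) set"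
    and f :: "'i \<Rightarrow> real^'d \<Rightarrow> real"
    and A :: "'i \<Rightarrow> real^'d^'m"
    and b ls :: "real^'m"
    and xs :: "'i \<Rightarrow> real \<Rightarrow> real^'m \<Rightarrow> real^'d"
    and H G :: real
  assumes X_ne: "\<And>i. X i \<noteq> {}"
    and X_convex: "\<And>i. convex (X i)"
    and f_convex: "\<And>i. convex_on (X i) (f i)"
    and f_bound: "\<And>i x. x \<in> X i \<Longrightarrow> \<bar>f i x\<bar> \<le> H"
    and g_bound: "\<And>i x. x \<in> X i \<Longrightarrow> norm (A i *v x - b) \<le> G"
    and lmo: "is_oracle X f A xs"
    and ls_nonneg: "0 \<le> ls"
    and ls_max: "\<And>l. 0 \<le> l \<Longrightarrow> dual_fun X f A b l \<le> dual_fun X f A b ls"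
    and near_optimal: "\<And>e. 0 < e \<Longrightarrow> \<exists>x. (\<forall>i. x i \<in> X i)
        \<and> (1 / real CARD('i)) *\<^sub>R (\<Sum>i\<in>UNIV. A i *v x i) \<le> b
        \<and> (1 / real CARD('i)) * (\<Sum>i\<in>UNIV. f i (x i)) < dual_fun X f A b ls + e"
begin

abbreviation dual :: "real^'m \<Rightarrow> real" where "dual \<equiv> dual_fun X f A b"
abbreviation diam :: "'i \<Rightarrow> real" where "diam i \<equiv> diameter (convex hull (C_set X f A i))"
abbreviation D :: real where "D \<equiv> D_const X f A"

lemma N_ge_1: "1 \<le> real CARD('i)"
  by (simp add: Suc_leI)

lemma N_pos: "0 < real CARD('i)"
  by simp

lemma H_nonneg: "0 \<le> H"
  using X_ne f_bound by (metis abs_ge_zero all_not_in_conv order.trans)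

lemma G_nonneg: "0 \<le> G"
  using X_ne g_bound by (metis norm_ge_zero all_not_in_conv order.trans)

lemma xs_in: "0 \<le> \<gamma> \<Longrightarrow> xs i \<gamma> l \<in> X i"
  using lmo by (auto simp: is_oracle_def is_arg_min_def)

lemma xs_min: "0 \<le> \<gamma> \<Longrightarrow> x \<in> X i \<Longrightarrow>
    \<gamma> * f i (xs i \<gamma> l) + l \<bullet> (A i *v xs i \<gamma> l) \<le> \<gamma> * f i x + l \<bullet> (A i *v x)"
  using lmo by (auto simp: is_oracle_def is_arg_min_def not_less)

section \<open>The dual function, weak duality and the oracle\<close>

lemma dual_eq:
  "dual l = (\<Sum>i\<in>UNIV. f i (xs i 1 l) + l \<bullet> (A i *v xs i 1 l - b)) / real CARD('i)"
proof -
  have "(INF x\<in>X i. f i x + l \<bullet> (A i *v x)) = f i (xs i 1 l) + l \<bullet> (A i *v xs i 1 l)" for i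
    using xs_in[of 1 i l] xs_min[of 1 _ i l] by (intro cInf_eq_minimum) auto
  then have "dual l = - (l \<bullet> b) + (\<Sum>i\<in>UNIV. f i (xs i 1 l) + l \<bullet> (A i *v xs i 1 l)) / real CARD('i)"
    by (simp add: dual_fun_def)
  also have "\<dots> = (\<Sum>i\<in>UNIV. f i (xs i 1 l) + l \<bullet> (A i *v xs i 1 l) - l \<bullet> b) / real CARD('i)"
    by (simp add: sum_subtractf diff_divide_distrib)
  finally show ?thesis by (simp add: inner_diff_right add_diff_eq)
qed

lemma dual_le:
  assumes "\<And>i. x i \<in> X i"
  shows "dual l \<le> (\<Sum>i\<in>UNIV. f i (x i) + l \<bullet> (A i *v x i - b)) / real CARD('i)"
  unfolding dual_eq using xs_min[of 1 "x _" _ l] assms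
  by (intro divide_right_mono sum_mono) (auto simp: inner_diff_right)

text \<open>Jensen's inequality for the concave dual. The block minimizers at the averaged point are
  admissible in every \<open>dual (l t)\<close>, and the resulting Lagrangian is affine in the
  multiplier.\<close>

lemma dual_average_ge:
  assumes "finite S" "S \<noteq> {}"
  shows "(\<Sum>t\<in>S. dual (l t)) / real (card S) \<le> dual ((1 / real (card S)) *\<^sub>R (\<Sum>t\<in>S. l t))"
proof -
  define la where "la = (1 / real (card S)) *\<^sub>R (\<Sum>t\<in>S. l t)"
  define g where "g i = A i *v xs i 1 la - b" for i
  have c: "real (card S) > 0" using assms by (simp add: card_gt_0_iff)
  then have la: "(\<Sum>t\<in>S. l t) = real (card S) *\<^sub>R la" by (simp add: la_def)
  have "(\<Sum>t\<in>S. dual (l t)) \<le> (\<Sum>t\<in>S. (\<Sum>i\<in>UNIV. f i (xs i 1 la) + l t \<bullet> g i) / real CARD('i))"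
    unfolding g_def by (intro sum_mono dual_le xs_in) simp
  also have "\<dots> = (\<Sum>i\<in>UNIV. \<Sum>t\<in>S. f i (xs i 1 la) + l t \<bullet> g i) / real CARD('i)"
    by (simp add: sum_divide_distrib[symmetric] sum.swap[of _ S])
  also have "\<dots> = (\<Sum>i\<in>UNIV. real (card S) * (f i (xs i 1 la) + la \<bullet> g i)) / real CARD('i)"
    by (simp add: sum.distrib inner_sum_left[symmetric] la algebra_simps)
  also have "\<dots> = real (card S) * dual la"
    unfolding dual_eq[of la] g_def by (simp add: sum_distrib_left)
  finally show ?thesis using c by (simp add: la_def divide_le_eq mult.commute)
qed

text \<open>Weak duality for infeasible points: an infeasible point can undercut the optimal value,
  but by no more than \<open>norm ls\<close> times its violation. It makes the initial excess
  amenable to signed estimates.\<close>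

lemma ls_le_objective:
  assumes "\<And>i. x i \<in> X i"
  shows "dual ls \<le> (\<Sum>i\<in>UNIV. f i (x i)) / real CARD('i)
      + norm ls * plus_norm ((1 / real CARD('i)) *\<^sub>R (\<Sum>i\<in>UNIV. A i *v x i) - b)"
proof -
  have "dual ls \<le> (\<Sum>i\<in>UNIV. f i (x i) + ls \<bullet> (A i *v x i - b)) / real CARD('i)"
    by (intro dual_le assms)
  also have "\<dots> = (\<Sum>i\<in>UNIV. f i (x i)) / real CARD('i) + ls \<bullet> ((1 / real CARD('i)) *\<^sub>R (\<Sum>i\<in>UNIV. A i *v x i) - b)"
    by (simp add: sum.distrib inner_diff_right inner_sum_right sum_subtractf add_divide_distrib diff_divide_distrib)
  also have "\<dots> \<le> (\<Sum>i\<in>UNIV. f i (x i)) / real CARD('i)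
      + norm ls * plus_norm ((1 / real CARD('i)) *\<^sub>R (\<Sum>i\<in>UNIV. A i *v x i) - b)"
    using inner_le_plus_norm[OF ls_nonneg] by simp
  finally show ?thesis .
qed

text \<open>Nearly optimal feasible points compete in the linear minimization, and
  \<open>g \<ge> 0\<close> turns their feasibility into \<open>g \<bullet> b\<close>. This is where
  strong duality enters the analysis of stage 2.\<close>

lemma lmo_sum_le:
  assumes "0 \<le> \<gamma>" "0 \<le> g"
  shows "(\<Sum>i\<in>UNIV. \<gamma> * f i (xs i \<gamma> g) + g \<bullet> (A i *v xs i \<gamma> g)) / real CARD('i) \<le> \<gamma> * dual ls + g \<bullet> b"
proof (rule field_le_epsilon)
  fix e :: real assume "0 < e"
  \<comment> \<open>The optimality error gets multiplied by \<open>\<gamma>\<close>, which may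
    vanish; the added 1 keeps the quotient meaningful.\<close>
  define e' where "e' = e / (\<gamma> + 1)"
  have e': "0 < e'" "\<gamma> * e' \<le> e" using \<open>0 < e\<close> assms(1) by (auto simp: e'_def field_simps)
  from near_optimal[OF e'(1)] obtain x where x: "\<And>i. x i \<in> X i"
      "(1 / real CARD('i)) *\<^sub>R (\<Sum>i\<in>UNIV. A i *v x i) \<le> b"
      "(1 / real CARD('i)) * (\<Sum>i\<in>UNIV. f i (x i)) < dual ls + e'"
    by blast
  have "(\<Sum>i\<in>UNIV. \<gamma> * f i (xs i \<gamma> g) + g \<bullet> (A i *v xs i \<gamma> g)) / real CARD('i)
      \<le> (\<Sum>i\<in>UNIV. \<gamma> * f i (x i) + g \<bullet> (A i *v x i)) / real CARD('i)"
    using assms(1) x(1) by (intro divide_right_mono sum_mono xs_min) auto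
  also have "\<dots> = \<gamma> * ((1 / real CARD('i)) * (\<Sum>i\<in>UNIV. f i (x i))) + g \<bullet> ((1 / real CARD('i)) *\<^sub>R (\<Sum>i\<in>UNIV. A i *v x i))"
    by (simp add: sum.distrib sum_distrib_left inner_sum_right add_divide_distrib sum_divide_distrib)
  also have "\<dots> \<le> \<gamma> * (dual ls + e') + g \<bullet> b"
  proof (intro add_mono mult_left_mono)
    show "g \<bullet> ((1 / real CARD('i)) *\<^sub>R (\<Sum>i\<in>UNIV. A i *v x i)) \<le> g \<bullet> b"
      using inner_nonneg_vec[OF assms(2), of "b - (1 / real CARD('i)) *\<^sub>R (\<Sum>i\<in>UNIV. A i *v x i)"] x(2)
      by (simp add: inner_diff_right)
  qed (use x(3) assms(1) in auto)
  also have "\<dots> \<le> \<gamma> * dual ls + g \<bullet> b + e" using e'(2) by (simp add: algebra_simps)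
  finally show "(\<Sum>i\<in>UNIV. \<gamma> * f i (xs i \<gamma> g) + g \<bullet> (A i *v xs i \<gamma> g)) / real CARD('i)
      \<le> \<gamma> * dual ls + g \<bullet> b + e" .
qed

text \<open>\<open>diameter\<close> controls distances only within bounded sets, so this is what
  allows the use of \<open>D\<close>.\<close>

lemma bounded_C_set: "bounded (C_set X f A i)"
proof -
  have "norm c \<le> H + (G + norm b)" if "c \<in> C_set X f A i" for c
  proof -
    from that obtain x where x: "x \<in> X i" and c: "c = (f i x, A i *v x)"
      by (auto simp: C_set_def)
    have "norm c \<le> norm (f i x) + norm (A i *v x)"
      unfolding c by (rule norm_Pair_le)
    also have "norm (A i *v x) \<le> norm (A i *v x - b) + norm b"
      using norm_triangle_ineq[of "A i *v x - b" b] by simp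
    finally show ?thesis using f_bound[OF x] g_bound[OF x] by simp
  qed
  then show ?thesis by (rule boundedI)
qed

lemma D_nonneg: "0 \<le> D"
  by (simp add: D_const_def sum_nonneg)

lemma D_square: "D\<^sup>2 = (\<Sum>i\<in>UNIV. (diam i)\<^sup>2) / real CARD('i)"
  by (simp add: D_const_def sum_nonneg)

subsection \<open>Stage 2\<close>

text \<open>The squared distance from the summed state to the orthant of pairs with objective at
  most \<open>dv\<close> and constraint value at most \<open>b\<close>.\<close>

definition merit :: "real \<Rightarrow> ('i, 'd, 'm) fw_state \<Rightarrow> real" where
  "merit dv st = (max ((\<Sum>i\<in>UNIV. fst st i) - dv) 0)\<^sup>2
     + (plus_norm ((\<Sum>i\<in>UNIV. fst (snd st) i) - b))\<^sup>2"

text \<open>The factor \<open>CARD('i)\<close> undoes the scaling of the state. Hull membership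
  bounds each displacement by the diameter. Averaging is exact for the linear constraint part, but
  \<open>\<beta>\<close> averages values of \<open>f\<close> and so only dominates \<open>f\<close>
  at the averaged point.\<close>

definition fw_inv :: "('i, 'd, 'm) fw_state \<Rightarrow> bool" where
  "fw_inv = (\<lambda>(\<beta>, z, x). \<forall>i. (real CARD('i) * \<beta> i, real CARD('i) *\<^sub>R z i) \<in> convex hull (C_set X f A i)
     \<and> x i \<in> X i \<and> f i (x i) \<le> real CARD('i) * \<beta> i \<and> real CARD('i) *\<^sub>R z i = A i *v x i)"

lemma merit_nonneg: "0 \<le> merit dv st"
  by (simp add: merit_def)

lemma fw_inv_init:
  assumes "\<And>i. x0 i \<in> X i"
  shows "fw_inv (fw_init f A x0)"
  using assms by (auto simp: fw_inv_def fw_init_def C_set_def intro!: hull_inc)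

lemma fw_inv_step:
  assumes "fw_inv st" "0 \<le> \<rho>" "\<rho> \<le> 1"
  shows "fw_inv (fw_step f A b xs dv \<rho> i st)"
proof -
  obtain \<beta> z x where st: "st = (\<beta>, z, x)" by (cases st)
  define y where "y = xs i (max ((\<Sum>j\<in>UNIV. \<beta> j) - dv) 0) (pos_part ((\<Sum>j\<in>UNIV. z j) - b))"
  have y: "y \<in> X i" unfolding y_def by (intro xs_in) simp
  have inv: "(real CARD('i) * \<beta> i, real CARD('i) *\<^sub>R z i) \<in> convex hull (C_set X f A i)" "x i \<in> X i"
      "f i (x i) \<le> real CARD('i) * \<beta> i" "real CARD('i) *\<^sub>R z i = A i *v x i"
    using assms(1) unfolding fw_inv_def st by blast+
  have \<beta>: "real CARD('i) * ((1 - \<rho>) * \<beta> i + (\<rho> / real CARD('i)) * f i y) = (1 - \<rho>) * (real CARD('i) * \<beta> i) + \<rho> * f i y"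
    by (simp add: algebra_simps)
  have z: "real CARD('i) *\<^sub>R ((1 - \<rho>) *\<^sub>R z i + (\<rho> / real CARD('i)) *\<^sub>R (A i *v y)) = (1 - \<rho>) *\<^sub>R (real CARD('i) *\<^sub>R z i) + \<rho> *\<^sub>R (A i *v y)"
    by (simp add: scaleR_add_right mult.commute)
  \<comment> \<open>The invariant for a single block, so that after the function updates only block
    \<open>i\<close> has to be examined again.\<close>
  define P where "P j B Z Y \<longleftrightarrow> (real CARD('i) * B, real CARD('i) *\<^sub>R Z) \<in> convex hull (C_set X f A j)
      \<and> Y \<in> X j \<and> f j Y \<le> real CARD('i) * B \<and> real CARD('i) *\<^sub>R Z = A j *v Y" for j B Z Y
  have fw_inv_iff: "fw_inv (u, v, w) \<longleftrightarrow> (\<forall>j. P j (u j) (v j) (w j))" for u v w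
    by (simp add: fw_inv_def P_def)
  have "(f i y, A i *v y) \<in> convex hull (C_set X f A i)"
    using y by (auto simp: C_set_def intro!: hull_inc)
  then have "(1 - \<rho>) *\<^sub>R (real CARD('i) * \<beta> i, real CARD('i) *\<^sub>R z i) + \<rho> *\<^sub>R (f i y, A i *v y) \<in> convex hull (C_set X f A i)"
    using inv(1) assms by (intro convexD) auto
  moreover have "(1 - \<rho>) *\<^sub>R x i + \<rho> *\<^sub>R y \<in> X i"
    using X_convex[of i] y inv(2) assms by (intro convexD) auto
  moreover have "f i ((1 - \<rho>) *\<^sub>R x i + \<rho> *\<^sub>R y) \<le> (1 - \<rho>) * (real CARD('i) * \<beta> i) + \<rho> * f i y"
  proof -
    have "f i ((1 - \<rho>) *\<^sub>R x i + \<rho> *\<^sub>R y) \<le> (1 - \<rho>) * f i (x i) + \<rho> * f i y"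
      using assms y inv(2) by (intro convex_onD[OF f_convex]) auto
    also have "\<dots> \<le> (1 - \<rho>) * (real CARD('i) * \<beta> i) + \<rho> * f i y"
      using assms inv(3) by (intro add_right_mono mult_left_mono) auto
    finally show ?thesis .
  qed
  moreover have "A i *v ((1 - \<rho>) *\<^sub>R x i + \<rho> *\<^sub>R y) = (1 - \<rho>) *\<^sub>R (real CARD('i) *\<^sub>R z i) + \<rho> *\<^sub>R (A i *v y)"
    by (simp only: inv(4) matrix_vector_right_distrib matrix_vector_mult_scaleR)
  ultimately have "P i ((1 - \<rho>) * \<beta> i + (\<rho> / real CARD('i)) * f i y)
      ((1 - \<rho>) *\<^sub>R z i + (\<rho> / real CARD('i)) *\<^sub>R (A i *v y)) ((1 - \<rho>) *\<^sub>R x i + \<rho> *\<^sub>R y)"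
    unfolding P_def \<beta> z by simp
  moreover have "fw_step f A b xs dv \<rho> i st
      = (\<beta>(i := (1 - \<rho>) * \<beta> i + (\<rho> / real CARD('i)) * f i y),
         z(i := (1 - \<rho>) *\<^sub>R z i + (\<rho> / real CARD('i)) *\<^sub>R (A i *v y)),
         x(i := (1 - \<rho>) *\<^sub>R x i + \<rho> *\<^sub>R y))"
    by (simp add: st fw_step_def Let_def y_def)
  ultimately show ?thesis
    using assms(1) by (simp add: st fw_inv_iff)
qed

text \<open>
  The gradient of half the merit at \<open>w = (\<beta>, z)\<close> is \<open>(a, (z - b)\<^sub>+)\<close>. Pairing it with the
  direction towards a primal solution gives \<open>a (dual ls - dv) - merit\<close>, where mere convexity
  would only give half of the merit; this doubles the exponent of the contraction of the excess.
\<close>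

lemma merit_step:
  fixes dv :: real
  assumes inv: "fw_inv st" and \<rho>: "0 \<le> \<rho>"
  defines "a \<equiv> max ((\<Sum>i\<in>UNIV. fst st i) - dv) 0"
  shows "(\<Sum>i\<in>UNIV. merit dv (fw_step f A b xs dv \<rho> i st)) / real CARD('i)
      \<le> merit dv st - 2 * (\<rho> / real CARD('i)) * (merit dv st - a * (dual ls - dv)) + (\<rho> / real CARD('i))\<^sup>2 * D\<^sup>2"
proof -
  obtain \<beta> z x where st: "st = (\<beta>, z, x)" by (cases st)
  define B Z where "B = (\<Sum>i\<in>UNIV. \<beta> i)" and "Z = (\<Sum>i\<in>UNIV. z i)"
  define q where "q = pos_part (Z - b)"
  define s where "s i = xs i a q" for i
  define \<delta> \<zeta> where "\<delta> i = f i (s i) / real CARD('i) - \<beta> i" and "\<zeta> i = (1 / real CARD('i)) *\<^sub>R (A i *v s i) - z i" for i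
  have a: "a = max (B - dv) 0" "0 \<le> a" by (auto simp: a_def B_def st)
  have m: "merit dv st = a\<^sup>2 + (plus_norm (Z - b))\<^sup>2"
    by (simp add: merit_def st a B_def Z_def)
  have step: "merit dv (fw_step f A b xs dv \<rho> i st)
      \<le> merit dv st + 2 * \<rho> * (a * \<delta> i + q \<bullet> \<zeta> i) + (\<rho> / real CARD('i))\<^sup>2 * (diam i)\<^sup>2" for i
  proof -
    have \<beta>: "(\<Sum>j\<in>UNIV. (\<beta>(i := (1 - \<rho>) * \<beta> i + (\<rho> / real CARD('i)) * f i (s i))) j) = B + \<rho> * \<delta> i"
      unfolding sum_fun_upd B_def \<delta>_def by (simp add: algebra_simps)
    have z: "(\<Sum>j\<in>UNIV. (z(i := (1 - \<rho>) *\<^sub>R z i + (\<rho> / real CARD('i)) *\<^sub>R (A i *v s i))) j) = Z + \<rho> *\<^sub>R \<zeta> i"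
      unfolding sum_fun_upd Z_def \<zeta>_def by (simp add: algebra_simps)
    have "merit dv (fw_step f A b xs dv \<rho> i st)
        = (max (B + \<rho> * \<delta> i - dv) 0)\<^sup>2 + (plus_norm (Z + \<rho> *\<^sub>R \<zeta> i - b))\<^sup>2"
      unfolding merit_def st fw_step_def
      using \<beta> z by (simp add: Let_def B_def[symmetric] Z_def[symmetric] a(1)[symmetric]
          q_def[symmetric] s_def[symmetric] del: fun_upd_apply)
    also have "\<dots> \<le> (a\<^sup>2 + 2 * a * (\<rho> * \<delta> i) + (\<rho> * \<delta> i)\<^sup>2)
        + ((plus_norm (Z - b))\<^sup>2 + 2 * (q \<bullet> (\<rho> *\<^sub>R \<zeta> i)) + (norm (\<rho> *\<^sub>R \<zeta> i))\<^sup>2)"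
      using max0_add_square_le[of "B - dv" "\<rho> * \<delta> i"] plus_norm_add_square_le[of "Z - b" "\<rho> *\<^sub>R \<zeta> i"]
      by (intro add_mono) (simp_all add: a(1) q_def algebra_simps)
    also have "\<dots> = merit dv st + 2 * \<rho> * (a * \<delta> i + q \<bullet> \<zeta> i) + \<rho>\<^sup>2 * ((\<delta> i)\<^sup>2 + (norm (\<zeta> i))\<^sup>2)"
      unfolding m by (simp add: power_mult_distrib algebra_simps)
    \<comment> \<open>Scaled by \<open>CARD('i)\<close>, the direction
      \<open>(\<delta> i, \<zeta> i)\<close> is the difference of two points of the convex hull of
      \<open>C_i\<close>. Joint treatment of both components is why the merit is a sum of
      squares.\<close>
    also have "(\<delta> i)\<^sup>2 + (norm (\<zeta> i))\<^sup>2 \<le> (diam i)\<^sup>2 / (real CARD('i))\<^sup>2"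
    proof -
      have "(f i (s i), A i *v s i) \<in> convex hull (C_set X f A i)"
        using xs_in[OF a(2), of i q] by (auto simp: C_set_def s_def intro!: hull_inc)
      moreover have "(real CARD('i) * \<beta> i, real CARD('i) *\<^sub>R z i) \<in> convex hull (C_set X f A i)"
        using inv unfolding fw_inv_def st by blast
      ultimately have "dist (f i (s i), A i *v s i) (real CARD('i) * \<beta> i, real CARD('i) *\<^sub>R z i) \<le> diam i"
        by (intro diameter_bounded_bound bounded_convex_hull bounded_C_set)
      moreover have "(f i (s i), A i *v s i) - (real CARD('i) * \<beta> i, real CARD('i) *\<^sub>R z i) = real CARD('i) *\<^sub>R (\<delta> i, \<zeta> i)"
        by (simp add: \<delta>_def \<zeta>_def algebra_simps)
      ultimately have "real CARD('i) * norm (\<delta> i, \<zeta> i) \<le> diam i"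
        by (simp only: dist_norm norm_scaleR abs_of_nonneg of_nat_0_le_iff)
      then have "(real CARD('i) * norm (\<delta> i, \<zeta> i))\<^sup>2 \<le> (diam i)\<^sup>2" by (intro power_mono) auto
      then show ?thesis
        by (simp add: norm_Pair power_mult_distrib field_simps)
    qed
    finally show ?thesis by (simp add: mult_left_mono power_divide)
  qed
  have "(\<Sum>i\<in>UNIV. a * \<delta> i + q \<bullet> \<zeta> i) \<le> a * (dual ls - dv) - merit dv st"
  proof -
    have "(\<Sum>i\<in>UNIV. a * \<delta> i + q \<bullet> \<zeta> i)
        = (\<Sum>i\<in>UNIV. (a * f i (s i) + q \<bullet> (A i *v s i)) / real CARD('i) - (a * \<beta> i + q \<bullet> z i))"
      by (intro sum.cong refl) (simp add: \<delta>_def \<zeta>_def algebra_simps add_divide_distrib inner_diff_right)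
    also have "\<dots> = (\<Sum>i\<in>UNIV. a * f i (s i) + q \<bullet> (A i *v s i)) / real CARD('i) - (a * B + q \<bullet> Z)"
      by (simp add: sum_subtractf sum_divide_distrib[symmetric] B_def Z_def sum.distrib sum_distrib_left inner_sum_right)
    also have "\<dots> \<le> a * dual ls + q \<bullet> b - (a * B + q \<bullet> Z)"
      using lmo_sum_le[OF a(2), of q] by (simp add: s_def q_def pos_part_nonneg)
    also have "\<dots> = a * (dual ls - dv) - a * (B - dv) - q \<bullet> (Z - b)"
      by (simp add: algebra_simps)
    \<comment> \<open>For a positive part, multiplication by the signed quantity already gives the
      full square; with the same fact for \<open>q\<close> the whole merit appears.\<close>
    also have "a * (B - dv) = a\<^sup>2" by (simp add: a(1) max_def power2_eq_square)
    also have "q \<bullet> (Z - b) = (plus_norm (Z - b))\<^sup>2" unfolding q_def by (rule inner_pos_part_self)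
    finally show ?thesis by (simp add: m)
  qed
  then have grad: "2 * (\<rho> / real CARD('i)) * (\<Sum>i\<in>UNIV. a * \<delta> i + q \<bullet> \<zeta> i)
      \<le> 2 * (\<rho> / real CARD('i)) * (a * (dual ls - dv) - merit dv st)"
    using \<rho> by (intro mult_left_mono) auto
  have "(\<Sum>i\<in>UNIV. merit dv (fw_step f A b xs dv \<rho> i st)) / real CARD('i)
      \<le> (\<Sum>i\<in>UNIV. merit dv st + 2 * \<rho> * (a * \<delta> i + q \<bullet> \<zeta> i) + (\<rho> / real CARD('i))\<^sup>2 * (diam i)\<^sup>2) / real CARD('i)"
    by (intro divide_right_mono sum_mono step) simp
  also have "\<dots> = merit dv st + 2 * (\<rho> / real CARD('i)) * (\<Sum>i\<in>UNIV. a * \<delta> i + q \<bullet> \<zeta> i) + (\<rho> / real CARD('i))\<^sup>2 * D\<^sup>2"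
    by (simp only: sum.distrib sum_distrib_left[symmetric] D_square add_divide_distrib sum_constant) simp
  finally show ?thesis using grad by (simp add: algebra_simps)
qed

text \<open>Adaptedness: the state after \<open>k\<close> steps sees only the first \<open>k\<close>
  indices. Hence index \<open>k\<close> can be averaged out with the state held fixed.\<close>

lemma fw_iter_cong:
  "(\<And>j. j < k \<Longrightarrow> r j = r' j) \<Longrightarrow> fw_iter f A b xs dv \<rho> x0 r k = fw_iter f A b xs dv \<rho> x0 r' k"
  by (induction k) auto

lemma fw_iter_upd: "fw_iter f A b xs dv \<rho> x0 (r(k := i)) k = fw_iter f A b xs dv \<rho> x0 r k"
  by (rule fw_iter_cong) simp

lemma fw_inv_iter:
  assumes "\<And>i. x0 i \<in> X i" "\<And>k. 0 \<le> \<rho> k" "\<And>k. \<rho> k \<le> 1"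
  shows "fw_inv (fw_iter f A b xs dv \<rho> x0 r k)"
  by (induction k) (auto intro: fw_inv_init fw_inv_step assms)

text \<open>Stage 1 is conditioned on, so \<open>dv\<close> and \<open>p\<close> are constants here.
  The stepsizes give \<open>\<rho> k / CARD('i) = 2 / (k + 2 * CARD('i))\<close>, the contraction
  rate for which the scalar recursion was solved; that recursion is applied to the squared excess of
  \<open>sqrt (E k)\<close> over \<open>p\<close>.\<close>

lemma stage2_bound:
  assumes x0: "\<And>i. x0 i \<in> X i" and dv: "dv \<le> dual ls" and K: "K \<ge> 1"
  defines "\<rho> \<equiv> \<lambda>k. 2 * real CARD('i) / (real k + 2 * real CARD('i))"
  shows "measure_pmf.expectation (unif_seq K) (\<lambda>r. sqrt (merit dv (fw_iter f A b xs dv \<rho> x0 r K)))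
      \<le> (dual ls - dv) + real CARD('i) / (2 * real K) * max (sqrt (merit dv (fw_init f A x0)) - (dual ls - dv)) 0
         + 2 * D / sqrt (real K)"
proof -
  define p where "p = dual ls - dv"
  define st where "st k r = fw_iter f A b xs dv \<rho> x0 r k" for k r
  define a where "a k r = max ((\<Sum>i\<in>UNIV. fst (st k r) i) - dv) 0" for k r
  define E where "E k = measure_pmf.expectation (unif_seq k) (\<lambda>r. merit dv (st k r))" for k
  have \<rho>: "0 \<le> \<rho> k" "\<rho> k \<le> 1" for k
    using N_pos by (auto simp: \<rho>_def divide_le_eq intro!: add_nonneg_pos)
  have E: "0 \<le> E k" for k unfolding E_def by (intro integral_nonneg_AE) (simp add: merit_nonneg)
  have p: "0 \<le> p" using dv by (simp add: p_def)
  have Esqrt: "measure_pmf.expectation (unif_seq k) (\<lambda>r. sqrt (merit dv (st k r))) \<le> sqrt (E k)" for k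
    by (rule expectation_le_sqrt) (simp_all add: E_def merit_nonneg)
  \<comment> \<open>\<open>a\<close> is one leg of the triangle whose hypotenuse is the root of the
    merit. This replaces the random factor of \<open>p\<close> by a function of \<open>E k\<close>,
    which closes the recursion.\<close>
  have Ea: "measure_pmf.expectation (unif_seq k) (a k) \<le> sqrt (E k)" for k
  proof -
    have "a k r \<le> sqrt (merit dv (st k r))" for r
      unfolding a_def merit_def by (intro real_le_rsqrt) simp
    then have "measure_pmf.expectation (unif_seq k) (a k)
        \<le> measure_pmf.expectation (unif_seq k) (\<lambda>r. sqrt (merit dv (st k r)))"
      by (intro expectation_mono_finite) auto
    with Esqrt[of k] show ?thesis by linarith
  qed
  have Estep: "E (Suc k) \<le> E k - 2 * (2 / (real k + 2 * real CARD('i))) * sqrt (E k) * (sqrt (E k) - p)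
      + (2 * D / (real k + 2 * real CARD('i)))\<^sup>2" for k
  proof -
    define c where "c = 2 / (real k + 2 * real CARD('i))"
    have c: "\<rho> k / real CARD('i) = c" "0 \<le> c" 
      using N_pos by (simp_all add: \<rho>_def c_def)
    have descent: "(\<Sum>i\<in>UNIV. merit dv (fw_step f A b xs dv (\<rho> k) i (st k r))) / real CARD('i)
        \<le> merit dv (st k r) - 2 * c * (merit dv (st k r) - a k r * p) + c\<^sup>2 * D\<^sup>2" for r
      unfolding c(1)[symmetric] a_def p_def
      by (rule merit_step) (simp_all add: st_def fw_inv_iter x0 \<rho>)
    have "E (Suc k) = measure_pmf.expectation (unif_seq k)
        (\<lambda>r. (\<Sum>i\<in>UNIV. merit dv (fw_step f A b xs dv (\<rho> k) i (st k r))) / real CARD('i))"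
      unfolding E_def expectation_unif_seq_Suc st_def by (simp add: fw_iter_upd)
    also have "\<dots> \<le> measure_pmf.expectation (unif_seq k)
        (\<lambda>r. merit dv (st k r) - 2 * c * (merit dv (st k r) - a k r * p) + c\<^sup>2 * D\<^sup>2)"
      using descent by (intro expectation_mono_finite) simp_all
    also have "\<dots> = E k - 2 * c * (E k - measure_pmf.expectation (unif_seq k) (a k) * p) + c\<^sup>2 * D\<^sup>2"
      by (simp add: E_def)
    also have "\<dots> \<le> E k - 2 * c * (E k - sqrt (E k) * p) + c\<^sup>2 * D\<^sup>2"
      using Ea c(2) p by (intro add_mono diff_mono mult_left_mono mult_right_mono) auto
    also have "E k - 2 * c * (E k - sqrt (E k) * p) = E k - 2 * c * sqrt (E k) * (sqrt (E k) - p)"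
      using E[of k] by (simp add: algebra_simps)
    finally show ?thesis by (simp add: c_def power_divide)
  qed
  define e where "e k = (max (sqrt (E k) - p) 0)\<^sup>2" for k
  have sqrt_e: "sqrt (e k) = max (sqrt (E k) - p) 0" for k by (simp add: e_def)
  have "sqrt (e K) \<le> real CARD('i) / (2 * real K) * sqrt (e 0) + 2 * D / sqrt (real K)"
  proof (rule fw_recursion)
    fix k
    show "e (Suc k) \<le> (1 - 2 / (real k + 2 * real CARD('i)))\<^sup>2 * e k + (2 * D / (real k + 2 * real CARD('i)))\<^sup>2"
      unfolding e_def
    proof (rule sqrt_recursion_step)
      show "2 / (real k + 2 * real CARD('i)) \<le> 1" using N_ge_1 by (subst divide_le_eq_1_pos) linarith+
      show "(sqrt (E (Suc k)))\<^sup>2 \<le> (sqrt (E k))\<^sup>2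
          - 2 * (2 / (real k + 2 * real CARD('i))) * sqrt (E k) * (sqrt (E k) - p) + (2 * D / (real k + 2 * real CARD('i)))\<^sup>2"
        using Estep[of k] E by simp
    qed (use p E in auto)
  qed (use K D_nonneg in \<open>auto simp: e_def Suc_leI\<close>)
  then have "sqrt (E K) \<le> p + (real CARD('i) / (2 * real K) * max (sqrt (E 0) - p) 0 + 2 * D / sqrt (real K))"
    unfolding sqrt_e by linarith
  moreover have "E 0 = merit dv (fw_init f A x0)"
    by (simp add: E_def st_def expectation_unif_seq_0)
  ultimately show ?thesis
    using Esqrt[of K] by (simp add: st_def p_def algebra_simps)
qed

end

subsection \<open>Stage 1\<close>

lemma sum_fibres:
  fixes s :: "nat \<Rightarrow> 'i::finite"
  shows "(\<Sum>i\<in>UNIV. \<Sum>t\<in>{t. t < n \<and> s t = i}. F i t) = (\<Sum>t<n. F (s t) t)"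
proof -
  have "(\<Sum>t<n. F (s t) t) = (\<Sum>i\<in>UNIV. \<Sum>t\<in>{t\<in>{..<n}. s t = i}. F (s t) t)"
    by (rule sum.group[symmetric]) auto
  also have "\<dots> = (\<Sum>i\<in>UNIV. \<Sum>t\<in>{t. t < n \<and> s t = i}. F i t)"
    by (intro sum.cong) auto
  finally show ?thesis by simp
qed

lemma card_fibre_upd:
  "card {t. t < Suc n \<and> (s(n := j)) t = i} = card {t. t < n \<and> s t = i} + (if j = i then 1 else 0)"
proof -
  have "{t. t < Suc n \<and> (s(n := j)) t = i} = (if j = i then insert n else id) {t. t < n \<and> s t = i}"
    by (auto simp: less_Suc_eq split: if_splits)
  then show ?thesis by simp
qed

text \<open>The binomial variance \<open>n * (1 / N) * (1 - 1 / N)\<close> plus a squared bias: each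
  draw adds a centred Bernoulli variable to the deviation. The offset \<open>c\<close> makes room
  for the extra visit that every block receives in the last step of stage 1.\<close>

lemma expectation_count_square:
  fixes i :: "'i::finite" and c :: real
  shows "measure_pmf.expectation (unif_seq n)
      (\<lambda>s. (real (card {t. t < n \<and> s t = i}) - real n / real CARD('i) + c)\<^sup>2)
      \<le> c\<^sup>2 + real n * (real CARD('i) - 1) / (real CARD('i))\<^sup>2"
proof -
  define N where "N = real CARD('i)"
  have N: "N > 0" by (simp add: N_def)
  define V where "V = (\<lambda>n s. (real (card {t. t < n \<and> s t = i}) - real n / N + c)\<^sup>2)"
  have "measure_pmf.expectation (unif_seq n) (V n) \<le> V 0 (\<lambda>_. undefined) + real n * ((N - 1) / N\<^sup>2)"
  proof (rule expectation_unif_seq_drift)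
    fix n s
    define y where "y = real (card {t. t < n \<and> s t = i}) - real n / N + c"
    have "(\<Sum>j\<in>UNIV. V (Suc n) (s(n := j))) = (\<Sum>j\<in>UNIV. (y - 1 / N + (if j = i then 1 else 0))\<^sup>2)"
      unfolding V_def y_def card_fibre_upd by (intro sum.cong) (auto simp: add_divide_distrib algebra_simps)
    also have "\<dots> = (\<Sum>j\<in>UNIV. (y - 1 / N)\<^sup>2 + (if j = i then 2 * (y - 1 / N) + 1 else 0))"
      by (intro sum.cong) (auto simp: power2_sum)
    also have "\<dots> = N * (y - 1 / N)\<^sup>2 + (2 * (y - 1 / N) + 1)"
      by (simp add: sum.distrib N_def)
    also have "\<dots> = N * (y\<^sup>2 + (N - 1) / N\<^sup>2)"
      using N by (simp add: field_simps power2_eq_square)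
    finally show "(\<Sum>j\<in>UNIV. V (Suc n) (s(n := j))) / real CARD('i) \<le> V n s + (N - 1) / N\<^sup>2"
      using N by (simp add: V_def y_def N_def[symmetric])
  qed
  then show ?thesis by (simp add: V_def N_def)
qed

section \<open>The projected stochastic subgradient method on the dual\<close>

context dual_decomposition
begin

text \<open>The average of \<open>gr i l\<close> over the blocks is a supergradient of the dual at
  \<open>l\<close>, so \<open>gr\<close> at a uniformly drawn block is an unbiased estimate of
  it.\<close>

definition gr :: "'i \<Rightarrow> real^'m \<Rightarrow> real^'m" where
  "gr i l = A i *v xs i 1 l - b"

abbreviation lam :: "real \<Rightarrow> (nat \<Rightarrow> 'i) \<Rightarrow> nat \<Rightarrow> real^'m" where
  "lam \<alpha> \<equiv> dual_iter A b xs 0 (\<lambda>_. \<alpha>)"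

lemma dual_eq_gr: "dual l = (\<Sum>i\<in>UNIV. f i (xs i 1 l) + l \<bullet> gr i l) / real CARD('i)"
  by (simp add: dual_eq gr_def)

lemma lam_Suc: "lam \<alpha> s (Suc t) = pos_part (lam \<alpha> s t + \<alpha> *\<^sub>R gr (s t) (lam \<alpha> s t))"
  by (simp add: Let_def gr_def)

lemma lam_cong: "(\<And>j. j < t \<Longrightarrow> s j = s' j) \<Longrightarrow> lam \<alpha> s t = lam \<alpha> s' t"
  by (induction t) auto

lemma lam_upd: "t \<le> n \<Longrightarrow> lam \<alpha> (s(n := i)) t = lam \<alpha> s t"
  by (rule lam_cong) simp

lemma lam_nonneg: "0 \<le> lam \<alpha> s t"
  by (cases t) (simp_all add: Let_def pos_part_nonneg)

lemma norm_gr_le: "norm (gr i l) \<le> G"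
  unfolding gr_def by (intro g_bound xs_in) simp

text \<open>Projection only raises coordinates and the start is 0, so the iterate dominates the
  unprojected sum of steps. A bound on the last multiplier thereby becomes a bound on the constraint
  violation accumulated along the path.\<close>

lemma sum_gr_le_lam:
  assumes "0 \<le> \<alpha>"
  shows "\<alpha> *\<^sub>R (\<Sum>t<n. gr (s t) (lam \<alpha> s t)) \<le> lam \<alpha> s n"
proof (induction n)
  case (Suc n)
  have "\<alpha> *\<^sub>R (\<Sum>t<Suc n. gr (s t) (lam \<alpha> s t)) \<le> lam \<alpha> s n + \<alpha> *\<^sub>R gr (s n) (lam \<alpha> s n)"
    using Suc by (simp add: scaleR_add_right)
  also have "\<dots> \<le> lam \<alpha> s (Suc n)" unfolding lam_Suc by (rule le_pos_part)
  finally show ?case .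
qed simp

text \<open>Nonexpansiveness of the projection removes the positive part; averaging over the blocks
  turns the cross term into the supergradient inequality between \<open>l\<close> and
  \<open>ls\<close>.\<close>

lemma subgradient_step_dist:
  assumes "0 \<le> \<alpha>"
  shows "(\<Sum>i\<in>UNIV. (norm (pos_part (l + \<alpha> *\<^sub>R gr i l) - ls))\<^sup>2) / real CARD('i)
      \<le> (norm (l - ls))\<^sup>2 - 2 * \<alpha> * (dual ls - dual l) + \<alpha>\<^sup>2 * G\<^sup>2"
proof -
  have "(norm (pos_part (l + \<alpha> *\<^sub>R gr i l) - ls))\<^sup>2
      \<le> (norm (l - ls))\<^sup>2 - 2 * \<alpha> * ((ls - l) \<bullet> gr i l) + \<alpha>\<^sup>2 * G\<^sup>2" for i
  proof -
    have "(norm (pos_part (l + \<alpha> *\<^sub>R gr i l) - ls))\<^sup>2 \<le> (norm (l + \<alpha> *\<^sub>R gr i l - ls))\<^sup>2"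
      by (intro power_mono norm_pos_part_diff_le ls_nonneg) simp
    also have "\<dots> = (norm (l - ls))\<^sup>2 - 2 * \<alpha> * ((ls - l) \<bullet> gr i l) + \<alpha>\<^sup>2 * (norm (gr i l))\<^sup>2"
      unfolding power2_norm_eq_inner
      by (simp add: inner_commute power2_eq_square algebra_simps)
    also have "\<alpha>\<^sup>2 * (norm (gr i l))\<^sup>2 \<le> \<alpha>\<^sup>2 * G\<^sup>2"
      by (intro mult_left_mono power_mono norm_gr_le) auto
    finally show ?thesis by simp
  qed
  then have "(\<Sum>i\<in>UNIV. (norm (pos_part (l + \<alpha> *\<^sub>R gr i l) - ls))\<^sup>2) / real CARD('i)
      \<le> (\<Sum>i\<in>UNIV. (norm (l - ls))\<^sup>2 - 2 * \<alpha> * ((ls - l) \<bullet> gr i l) + \<alpha>\<^sup>2 * G\<^sup>2) / real CARD('i)"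
    by (intro divide_right_mono sum_mono) auto
  also have "\<dots> = (norm (l - ls))\<^sup>2 - 2 * \<alpha> * ((\<Sum>i\<in>UNIV. (ls - l) \<bullet> gr i l) / real CARD('i)) + \<alpha>\<^sup>2 * G\<^sup>2"
    by (simp add: sum.distrib sum_subtractf sum_distrib_left[symmetric] add_divide_distrib diff_divide_distrib)
  finally have step: "(\<Sum>i\<in>UNIV. (norm (pos_part (l + \<alpha> *\<^sub>R gr i l) - ls))\<^sup>2) / real CARD('i)
      \<le> (norm (l - ls))\<^sup>2 - 2 * \<alpha> * ((\<Sum>i\<in>UNIV. (ls - l) \<bullet> gr i l) / real CARD('i)) + \<alpha>\<^sup>2 * G\<^sup>2" .
  have "dual ls - dual l \<le> (\<Sum>i\<in>UNIV. (ls - l) \<bullet> gr i l) / real CARD('i)"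
  proof -
    have "dual ls \<le> (\<Sum>i\<in>UNIV. f i (xs i 1 l) + ls \<bullet> gr i l) / real CARD('i)"
      unfolding gr_def by (intro dual_le xs_in) simp
    also have "\<dots> = (\<Sum>i\<in>UNIV. (f i (xs i 1 l) + l \<bullet> gr i l) + (ls - l) \<bullet> gr i l) / real CARD('i)"
      by (simp add: inner_diff_left)
    also have "\<dots> = dual l + (\<Sum>i\<in>UNIV. (ls - l) \<bullet> gr i l) / real CARD('i)"
      by (simp only: sum.distrib[of _ "\<lambda>i. (ls - l) \<bullet> gr i l"] add_divide_distrib dual_eq_gr)
    finally show ?thesis by simp
  qed
  then have "2 * \<alpha> * (dual ls - dual l) \<le> 2 * \<alpha> * ((\<Sum>i\<in>UNIV. (ls - l) \<bullet> gr i l) / real CARD('i))"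
    using assms by (intro mult_left_mono) auto
  with step show ?thesis by linarith
qed

text \<open>Measured from the origin instead of \<open>ls\<close>, the squared norm produces the
  cross term \<open>l \<bullet> gr i l\<close>. This is what the objective values lack to form the
  Lagrangian, whose average is \<open>dual l \<le> dual ls\<close>.\<close>

lemma subgradient_step_objective:
  assumes "0 < \<alpha>" "0 \<le> l"
  shows "(\<Sum>i\<in>UNIV. f i (xs i 1 l) + (norm (pos_part (l + \<alpha> *\<^sub>R gr i l)))\<^sup>2 / (2 * \<alpha>)) / real CARD('i)
      \<le> dual ls + (norm l)\<^sup>2 / (2 * \<alpha>) + \<alpha> * G\<^sup>2 / 2"
proof -
  have "(norm (pos_part (l + \<alpha> *\<^sub>R gr i l)))\<^sup>2 / (2 * \<alpha>)
      \<le> (norm l)\<^sup>2 / (2 * \<alpha>) + l \<bullet> gr i l + \<alpha> * G\<^sup>2 / 2" for i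
  proof -
    have "(norm (pos_part (l + \<alpha> *\<^sub>R gr i l)))\<^sup>2 \<le> (norm (l + \<alpha> *\<^sub>R gr i l))\<^sup>2"
      using norm_pos_part_diff_le[of 0 "l + \<alpha> *\<^sub>R gr i l"] by (intro power_mono) auto
    also have "\<dots> = (norm l)\<^sup>2 + 2 * \<alpha> * (l \<bullet> gr i l) + \<alpha>\<^sup>2 * (norm (gr i l))\<^sup>2"
      unfolding power2_norm_eq_inner
      by (simp add: inner_commute power2_eq_square algebra_simps)
    also have "\<alpha>\<^sup>2 * (norm (gr i l))\<^sup>2 \<le> \<alpha>\<^sup>2 * G\<^sup>2"
      by (intro mult_left_mono power_mono norm_gr_le) auto
    finally show ?thesis using assms(1) by (simp add: field_simps power2_eq_square)
  qed
  then have "(\<Sum>i\<in>UNIV. f i (xs i 1 l) + (norm (pos_part (l + \<alpha> *\<^sub>R gr i l)))\<^sup>2 / (2 * \<alpha>)) / real CARD('i)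
      \<le> (\<Sum>i\<in>UNIV. f i (xs i 1 l) + ((norm l)\<^sup>2 / (2 * \<alpha>) + l \<bullet> gr i l + \<alpha> * G\<^sup>2 / 2)) / real CARD('i)"
    by (intro divide_right_mono sum_mono add_left_mono) auto
  also have "\<dots> = (\<Sum>i\<in>UNIV. (f i (xs i 1 l) + l \<bullet> gr i l) + ((norm l)\<^sup>2 / (2 * \<alpha>) + \<alpha> * G\<^sup>2 / 2)) / real CARD('i)"
    by (simp add: algebra_simps)
  also have "\<dots> = dual l + ((norm l)\<^sup>2 / (2 * \<alpha>) + \<alpha> * G\<^sup>2 / 2)"
    by (simp only: sum.distrib[of _ "\<lambda>i. (norm l)\<^sup>2 / (2 * \<alpha>) + \<alpha> * G\<^sup>2 / 2"] add_divide_distrib dual_eq_gr) simp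
  finally show ?thesis using ls_max[OF assms(2)] by simp
qed

text \<open>The potential carries the dual gaps of the past along with the squared distance; the new
  gap exactly compensates the expected decrease of the distance.\<close>

lemma expectation_dist:
  assumes "0 \<le> \<alpha>"
  shows "measure_pmf.expectation (unif_seq n)
      (\<lambda>s. (norm (lam \<alpha> s n - ls))\<^sup>2 + 2 * \<alpha> * (\<Sum>t<n. dual ls - dual (lam \<alpha> s t)))
      \<le> (norm ls)\<^sup>2 + real n * \<alpha>\<^sup>2 * G\<^sup>2"
proof -
  define V where "V = (\<lambda>n s. (norm (lam \<alpha> s n - ls))\<^sup>2 + 2 * \<alpha> * (\<Sum>t<n. dual ls - dual (lam \<alpha> s t)))"
  have "measure_pmf.expectation (unif_seq n) (V n) \<le> V 0 (\<lambda>_. undefined) + real n * (\<alpha>\<^sup>2 * G\<^sup>2)"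
  proof (rule expectation_unif_seq_drift)
    fix n s
    define l where "l = lam \<alpha> s n"
    define c where "c = 2 * \<alpha> * (\<Sum>t<Suc n. dual ls - dual (lam \<alpha> s t))"
    have "V (Suc n) (s(n := i)) = (norm (pos_part (l + \<alpha> *\<^sub>R gr i l) - ls))\<^sup>2 + c" for i
      unfolding V_def c_def lam_Suc l_def by (simp add: lam_upd)
    then have "(\<Sum>i\<in>UNIV. V (Suc n) (s(n := i))) / real CARD('i)
        = (\<Sum>i\<in>UNIV. (norm (pos_part (l + \<alpha> *\<^sub>R gr i l) - ls))\<^sup>2) / real CARD('i) + c"
      by (simp add: sum.distrib add_divide_distrib)
    also have "\<dots> \<le> (norm (l - ls))\<^sup>2 - 2 * \<alpha> * (dual ls - dual l) + \<alpha>\<^sup>2 * G\<^sup>2 + c"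
      using subgradient_step_dist[OF assms] by simp
    also have "\<dots> = V n s + \<alpha>\<^sup>2 * G\<^sup>2" by (simp add: V_def c_def l_def algebra_simps)
    finally show "(\<Sum>i\<in>UNIV. V (Suc n) (s(n := i))) / real CARD('i) \<le> V n s + \<alpha>\<^sup>2 * G\<^sup>2" .
  qed
  then show ?thesis unfolding V_def by (simp only: mult.assoc) simp
qed

text \<open>One \<open>norm ls\<close> is the initial distance from 0 to \<open>ls\<close>, the
  other comes from the triangle inequality back to the origin.\<close>

lemma expectation_norm_lam:
  assumes "0 \<le> \<alpha>"
  shows "measure_pmf.expectation (unif_seq n) (\<lambda>s. norm (lam \<alpha> s n))
      \<le> 2 * norm ls + sqrt (real n) * \<alpha> * G"
proof -
  have "measure_pmf.expectation (unif_seq n) (\<lambda>s. (norm (lam \<alpha> s n - ls))\<^sup>2)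
      \<le> measure_pmf.expectation (unif_seq n)
        (\<lambda>s. (norm (lam \<alpha> s n - ls))\<^sup>2 + 2 * \<alpha> * (\<Sum>t<n. dual ls - dual (lam \<alpha> s t)))"
    using assms ls_max[OF lam_nonneg] by (intro expectation_mono_finite) (auto intro!: mult_nonneg_nonneg sum_nonneg)
  also note expectation_dist[OF assms]
  finally have "measure_pmf.expectation (unif_seq n) (\<lambda>s. norm (lam \<alpha> s n - ls))
      \<le> sqrt ((norm ls)\<^sup>2 + real n * \<alpha>\<^sup>2 * G\<^sup>2)"
    by (intro expectation_le_sqrt) simp_all
  also have "\<dots> \<le> norm ls + sqrt (real n) * \<alpha> * G"
    using assms G_nonneg
    by (intro real_le_lsqrt) (auto simp: power2_sum power_mult_distrib)
  finally have *: "measure_pmf.expectation (unif_seq n) (\<lambda>s. norm (lam \<alpha> s n - ls))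
      \<le> norm ls + sqrt (real n) * \<alpha> * G" .
  have "measure_pmf.expectation (unif_seq n) (\<lambda>s. norm (lam \<alpha> s n))
      \<le> measure_pmf.expectation (unif_seq n) (\<lambda>s. norm (lam \<alpha> s n - ls) + norm ls)"
    using norm_triangle_ineq[of "lam \<alpha> _ n - ls" ls] by (intro expectation_mono_finite) auto
  also have "\<dots> = measure_pmf.expectation (unif_seq n) (\<lambda>s. norm (lam \<alpha> s n - ls)) + norm ls"
    by simp
  finally show ?thesis using * by simp
qed

text \<open>Only \<open>T - 1\<close> indices are drawn, but \<open>T\<close> iterates are averaged;
  the gap of the last iterate must be paid for without a sampled step.\<close>

lemma expectation_dual_gap:
  assumes "0 < \<alpha>" "1 \<le> T"
  shows "measure_pmf.expectation (unif_seq (T - 1)) (\<lambda>s. dual ls - dual (dual_avg A b xs 0 (\<lambda>_. \<alpha>) T s))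
      \<le> (norm ls)\<^sup>2 / (2 * \<alpha> * real T) + \<alpha> * G\<^sup>2 / 2"
proof -
  define n where "n = T - 1"
  have T: "T = Suc n" using assms by (simp add: n_def)
  define V where "V = (\<lambda>s. (norm (lam \<alpha> s n - ls))\<^sup>2 + 2 * \<alpha> * (\<Sum>t<n. dual ls - dual (lam \<alpha> s t)))"
  have "dual ls - dual (dual_avg A b xs 0 (\<lambda>_. \<alpha>) T s) \<le> (V s + \<alpha>\<^sup>2 * G\<^sup>2) / (2 * \<alpha> * real T)" for s
  proof -
    \<comment> \<open>A fictitious further step: its mean squared distance to \<open>ls\<close> is
      nonnegative, which bounds the last gap by the remaining distance plus one more noise
      term.\<close>
    have "0 \<le> (norm (lam \<alpha> s n - ls))\<^sup>2 - 2 * \<alpha> * (dual ls - dual (lam \<alpha> s n)) + \<alpha>\<^sup>2 * G\<^sup>2"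
      using assms by (intro order.trans[OF _ subgradient_step_dist] divide_nonneg_nonneg sum_nonneg) auto
    then have "2 * \<alpha> * (\<Sum>t<T. dual ls - dual (lam \<alpha> s t)) \<le> V s + \<alpha>\<^sup>2 * G\<^sup>2"
      by (simp add: T V_def algebra_simps)
    moreover have "dual ls - dual (dual_avg A b xs 0 (\<lambda>_. \<alpha>) T s) \<le> (\<Sum>t<T. dual ls - dual (lam \<alpha> s t)) / real T"
      using dual_average_ge[of "{..<T}" "lam \<alpha> s"] assms(2)
      by (simp add: dual_avg_def sum_subtractf diff_divide_distrib lessThan_empty_iff)
    moreover have "(\<Sum>t<T. dual ls - dual (lam \<alpha> s t)) / real T \<le> (V s + \<alpha>\<^sup>2 * G\<^sup>2) / (2 * \<alpha>) / real T"
      using assms calculation(1) by (intro divide_right_mono) (auto simp: pos_le_divide_eq mult.commute)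
    ultimately show ?thesis by simp
  qed
  then have "measure_pmf.expectation (unif_seq n) (\<lambda>s. dual ls - dual (dual_avg A b xs 0 (\<lambda>_. \<alpha>) T s))
      \<le> measure_pmf.expectation (unif_seq n) (\<lambda>s. (V s + \<alpha>\<^sup>2 * G\<^sup>2) / (2 * \<alpha> * real T))"
    by (intro expectation_mono_finite) auto
  also have "\<dots> = (measure_pmf.expectation (unif_seq n) V + \<alpha>\<^sup>2 * G\<^sup>2) / (2 * \<alpha> * real T)"
    by simp
  also have "\<dots> \<le> ((norm ls)\<^sup>2 + real n * \<alpha>\<^sup>2 * G\<^sup>2 + \<alpha>\<^sup>2 * G\<^sup>2) / (2 * \<alpha> * real T)"
    unfolding V_def using expectation_dist[of \<alpha> n] assms by (intro divide_right_mono add_right_mono) auto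
  also have "\<dots> = (norm ls)\<^sup>2 / (2 * \<alpha> * real T) + \<alpha> * G\<^sup>2 / 2"
  proof -
    have eq: "(norm ls)\<^sup>2 + real n * \<alpha>\<^sup>2 * G\<^sup>2 + \<alpha>\<^sup>2 * G\<^sup>2
        = (norm ls)\<^sup>2 + (2 * \<alpha> * real T) * (\<alpha> * G\<^sup>2 / 2)"
      by (simp add: T algebra_simps power2_eq_square)
    show ?thesis unfolding eq using assms by (simp add: add_divide_distrib)
  qed
  finally show ?thesis by (simp add: n_def)
qed

lemma expectation_objective:
  assumes "0 < \<alpha>"
  shows "measure_pmf.expectation (unif_seq n) (\<lambda>s. \<Sum>t<n. f (s t) (xs (s t) 1 (lam \<alpha> s t)) - dual ls)
      \<le> real n * (\<alpha> * G\<^sup>2 / 2)"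
proof -
  define F where "F s t = f (s t) (xs (s t) 1 (lam \<alpha> s t)) - dual ls" for s t
  define V where "V = (\<lambda>n s. (\<Sum>t<n. F s t) + (norm (lam \<alpha> s n))\<^sup>2 / (2 * \<alpha>))"
  have "measure_pmf.expectation (unif_seq n) (V n) \<le> V 0 (\<lambda>_. undefined) + real n * (\<alpha> * G\<^sup>2 / 2)"
  proof (rule expectation_unif_seq_drift)
    fix n s
    define l where "l = lam \<alpha> s n"
    define c where "c = (\<Sum>t<n. F s t) - dual ls"
    have "V (Suc n) (s(n := i)) = (f i (xs i 1 l) + (norm (pos_part (l + \<alpha> *\<^sub>R gr i l)))\<^sup>2 / (2 * \<alpha>)) + c" for i
    proof -
      have "(\<Sum>t<n. F (s(n := i)) t) = (\<Sum>t<n. F s t)"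
        by (intro sum.cong) (auto simp: F_def lam_upd)
      then show ?thesis
        unfolding V_def c_def lam_Suc l_def by (simp add: lam_upd F_def)
    qed
    then have "(\<Sum>i\<in>UNIV. V (Suc n) (s(n := i))) / real CARD('i)
        = (\<Sum>i\<in>UNIV. f i (xs i 1 l) + (norm (pos_part (l + \<alpha> *\<^sub>R gr i l)))\<^sup>2 / (2 * \<alpha>)) / real CARD('i) + c"
      by (simp add: sum.distrib[of _ "\<lambda>_. c"] add_divide_distrib)
    also have "\<dots> \<le> dual ls + (norm l)\<^sup>2 / (2 * \<alpha>) + \<alpha> * G\<^sup>2 / 2 + c"
      using subgradient_step_objective[OF assms, of l] by (simp add: l_def lam_nonneg)
    also have "\<dots> = V n s + \<alpha> * G\<^sup>2 / 2" by (simp add: V_def c_def l_def)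
    finally show "(\<Sum>i\<in>UNIV. V (Suc n) (s(n := i))) / real CARD('i) \<le> V n s + \<alpha> * G\<^sup>2 / 2" .
  qed
  then have *: "measure_pmf.expectation (unif_seq n) (V n) \<le> real n * (\<alpha> * G\<^sup>2 / 2)" by (simp add: V_def)
  have "measure_pmf.expectation (unif_seq n) (\<lambda>s. \<Sum>t<n. F s t) \<le> measure_pmf.expectation (unif_seq n) (V n)"
    using assms by (intro expectation_mono_finite) (auto simp: V_def)
  with * show ?thesis by (simp only: F_def)
qed

subsection \<open>The starting point of stage 2\<close>

definition visits :: "nat \<Rightarrow> (nat \<Rightarrow> 'i) \<Rightarrow> 'i \<Rightarrow> real" where
  "visits T s i = real (card {t. t < T - 1 \<and> s t = i}) + 1"

text \<open>The ideal number of visits is \<open>T / CARD('i)\<close>, whereas the counts sum to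
  \<open>T - 1 + CARD('i)\<close>, because the last step visits every block. So the deviation
  combines sampling noise with a systematic bias.\<close>

definition imbalance :: "nat \<Rightarrow> (nat \<Rightarrow> 'i) \<Rightarrow> real" where
  "imbalance T s = (\<Sum>i\<in>UNIV. \<bar>1 / real CARD('i) - visits T s i / real T\<bar>)"

definition picks :: "nat \<Rightarrow> (nat \<Rightarrow> 'i) \<Rightarrow> 'i \<Rightarrow> nat set" where
  "picks T s i = insert (T - 1) {t. t < T - 1 \<and> s t = i}"

abbreviation start :: "real \<Rightarrow> nat \<Rightarrow> (nat \<Rightarrow> 'i) \<Rightarrow> 'i \<Rightarrow> real^'d" where
  "start \<alpha> \<equiv> primal_avg A b xs 0 (\<lambda>_. \<alpha>)"

definition start_infeas :: "real \<Rightarrow> nat \<Rightarrow> (nat \<Rightarrow> 'i) \<Rightarrow> real" where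
  "start_infeas \<alpha> T s = plus_norm ((1 / real CARD('i)) *\<^sub>R (\<Sum>i\<in>UNIV. A i *v start \<alpha> T s i) - b)"

definition start_subopt :: "real \<Rightarrow> nat \<Rightarrow> (nat \<Rightarrow> 'i) \<Rightarrow> real" where
  "start_subopt \<alpha> T s = (\<Sum>i\<in>UNIV. f i (start \<alpha> T s i)) / real CARD('i) - dual ls"

lemma finite_picks [simp]: "finite (picks T s i)"
  by (simp add: picks_def)

lemma card_picks: "real (card (picks T s i)) = visits T s i"
  by (simp add: picks_def visits_def)

lemma visits_pos: "0 < visits T s i"
  by (simp add: visits_def)

lemma start_eq: "start \<alpha> T s i = (\<Sum>t\<in>picks T s i. (1 / visits T s i) *\<^sub>R xs i 1 (lam \<alpha> s t))"
  by (simp add: primal_avg_def Let_def picks_def visits_def scaleR_sum_right scaleR_add_right add.commute)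

lemma sum_weights: "(\<Sum>t\<in>picks T s i. 1 / visits T s i) = 1"
  using visits_pos[of T s i] by (simp add: card_picks)

text \<open>Time \<open>T - 1\<close> belongs to the picks of every block, hence it contributes one
  term per block, while each earlier time contributes only one term.\<close>

lemma sum_picks:
  "(\<Sum>i\<in>UNIV. \<Sum>t\<in>picks T s i. F i t) = (\<Sum>t<T-1. F (s t) t) + (\<Sum>i\<in>UNIV. F i (T - 1))"
  unfolding picks_def by (simp add: sum.distrib sum_fibres add.commute)

lemma start_in: "start \<alpha> T s i \<in> X i"
  unfolding start_eq using visits_pos[of T s i]
  by (intro convex_sum X_convex sum_weights xs_in) auto

lemma f_start_le: "f i (start \<alpha> T s i) \<le> (\<Sum>t\<in>picks T s i. f i (xs i 1 (lam \<alpha> s t))) / visits T s i"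
proof -
  have "f i (start \<alpha> T s i) \<le> (\<Sum>t\<in>picks T s i. (1 / visits T s i) * f i (xs i 1 (lam \<alpha> s t)))"
    unfolding start_eq using visits_pos[of T s i]
    by (intro convex_on_sum[OF _ _ f_convex] sum_weights xs_in) (auto simp: picks_def)
  then show ?thesis by (simp add: sum_divide_distrib)
qed

lemma g_start_eq:
  "A i *v start \<alpha> T s i - b = (1 / visits T s i) *\<^sub>R (\<Sum>t\<in>picks T s i. gr i (lam \<alpha> s t))"
proof -
  have "A i *v start \<alpha> T s i - b
      = (\<Sum>t\<in>picks T s i. (1 / visits T s i) *\<^sub>R (A i *v xs i 1 (lam \<alpha> s t)))
        - (\<Sum>t\<in>picks T s i. 1 / visits T s i) *\<^sub>R b"
    unfolding sum_weights by (simp add: start_eq linear_sum[OF matrix_vector_mul_linear] matrix_vector_mult_scaleR)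
  then show ?thesis
    by (simp only: scaleR_sum_left sum_subtractf[symmetric] scaleR_diff_right[symmetric] gr_def scaleR_sum_right)
qed

lemma start_infeas_eq:
  "start_infeas \<alpha> T s
    = plus_norm (\<Sum>i\<in>UNIV. (1 / (real CARD('i) * visits T s i)) *\<^sub>R (\<Sum>t\<in>picks T s i. gr i (lam \<alpha> s t)))"
proof -
  have "(1 / real CARD('i)) *\<^sub>R (\<Sum>i\<in>UNIV. A i *v start \<alpha> T s i) - b
      = (1 / real CARD('i)) *\<^sub>R (\<Sum>i\<in>UNIV. A i *v start \<alpha> T s i - b)"
    by (simp add: sum_subtractf scaleR_diff_right sum_constant_scaleR del: sum_constant)
  also have "\<dots> = (\<Sum>i\<in>UNIV. (1 / (real CARD('i) * visits T s i)) *\<^sub>R (\<Sum>t\<in>picks T s i. gr i (lam \<alpha> s t)))"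
    by (simp add: g_start_eq scaleR_sum_right[of "1 / real CARD('i)" _ UNIV])
  finally show ?thesis by (simp add: start_infeas_def)
qed

lemma start_infeas_nonneg: "0 \<le> start_infeas \<alpha> T s"
  by (simp add: start_infeas_def plus_norm_nonneg)

text \<open>The weight of an evaluation in the blockwise average is the ideal weight
  \<open>1 / T\<close> along the trajectory plus a correction. Divided by \<open>visits\<close>, the
  correction multiplies a block average, which is at most \<open>H\<close> or \<open>G\<close>, so
  its total cost is the imbalance.\<close>

lemma weight_split:
  assumes "1 \<le> T"
  shows "1 / (real CARD('i) * visits T s i)
    = 1 / real T + (1 / real CARD('i) - visits T s i / real T) / visits T s i"
  using assms visits_pos[of T s i] N_pos by (simp add: field_simps)

lemma start_subopt_le:
  assumes "1 \<le> T"
  shows "start_subopt \<alpha> T s \<le> (\<Sum>t<T-1. f (s t) (xs (s t) 1 (lam \<alpha> s t)) - dual ls) / real T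
     + ((real CARD('i) - 1) * H + G * norm (lam \<alpha> s (T - 1))) / real T + H * imbalance T s"
proof -
  define V where "V i = (\<Sum>t\<in>picks T s i. f i (xs i 1 (lam \<alpha> s t)))" for i
  define w where "w i = 1 / real CARD('i) - visits T s i / real T" for i
  define l where "l = lam \<alpha> s (T - 1)"
  define m where "m = (\<Sum>i\<in>UNIV. f i (xs i 1 l)) / real CARD('i)"
  have V: "\<bar>V i\<bar> \<le> visits T s i * H" for i
  proof -
    have "\<bar>V i\<bar> \<le> (\<Sum>t\<in>picks T s i. H)"
      unfolding V_def by (intro order.trans[OF sum_abs] sum_mono f_bound xs_in) simp
    then show ?thesis by (simp add: card_picks)
  qed
  have "(\<Sum>i\<in>UNIV. f i (start \<alpha> T s i)) / real CARD('i) \<le> (\<Sum>i\<in>UNIV. V i / visits T s i) / real CARD('i)"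
    unfolding V_def by (intro divide_right_mono sum_mono f_start_le) simp
  also have "\<dots> = (\<Sum>i\<in>UNIV. V i / real T + w i * (V i / visits T s i))"
    unfolding sum_divide_distrib
  proof (intro sum.cong refl)
    fix i
    have "V i / visits T s i / real CARD('i) = V i * (1 / (real CARD('i) * visits T s i))" by simp
    also have "\<dots> = V i / real T + w i * (V i / visits T s i)"
      unfolding weight_split[OF assms] w_def by (simp add: distrib_left mult.commute)
    finally show "V i / visits T s i / real CARD('i) = V i / real T + w i * (V i / visits T s i)" .
  qed
  also have "\<dots> \<le> (\<Sum>i\<in>UNIV. V i / real T + \<bar>w i\<bar> * H)"
  proof (intro sum_mono add_left_mono)
    fix i
    have "w i * (V i / visits T s i) \<le> \<bar>w i\<bar> * \<bar>V i / visits T s i\<bar>"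
      by (metis abs_ge_self abs_mult)
    also have "\<bar>V i / visits T s i\<bar> \<le> H"
      using V[of i] visits_pos[of T s i] by (simp add: abs_divide pos_divide_le_eq mult.commute)
    finally show "w i * (V i / visits T s i) \<le> \<bar>w i\<bar> * H" by (simp add: mult_left_mono)
  qed
  also have "\<dots> = (\<Sum>i\<in>UNIV. V i) / real T + H * imbalance T s"
    by (simp add: sum.distrib sum_divide_distrib imbalance_def w_def sum_distrib_left mult.commute)
  also have "(\<Sum>i\<in>UNIV. V i) = (\<Sum>t<T-1. f (s t) (xs (s t) 1 (lam \<alpha> s t))) + real CARD('i) * m"
    unfolding V_def sum_picks m_def l_def by simp
  finally have 1: "start_subopt \<alpha> T s \<le> ((\<Sum>t<T-1. f (s t) (xs (s t) 1 (lam \<alpha> s t))) + real CARD('i) * m) / real T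
      + H * imbalance T s - dual ls"
    by (simp add: start_subopt_def)
  \<comment> \<open>The last full pass evaluates \<open>CARD('i)\<close> blocks but fills only one
    of the \<open>T\<close> time slots. One copy of its mean is compared with
    \<open>dual ls\<close>; the surplus copies are bounded by \<open>H\<close>.\<close>
  have "real CARD('i) * m = m + (real CARD('i) - 1) * m" by (simp add: algebra_simps)
  also have "\<dots> \<le> (dual ls + G * norm l) + (real CARD('i) - 1) * H"
  proof (intro add_mono mult_left_mono)
    have "m = dual l + (\<Sum>i\<in>UNIV. - (l \<bullet> gr i l)) / real CARD('i)"
      by (simp add: m_def dual_eq_gr sum.distrib sum_negf add_divide_distrib)
    also have "(\<Sum>i\<in>UNIV. - (l \<bullet> gr i l)) \<le> (\<Sum>i\<in>(UNIV::'i set). G * norm l)"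
    proof (intro sum_mono)
      fix i
      have "- (l \<bullet> gr i l) \<le> norm l * norm (gr i l)"
        using Cauchy_Schwarz_ineq2[of l "gr i l"] by linarith
      also have "\<dots> \<le> norm l * G" by (intro mult_left_mono norm_gr_le) simp
      finally show "- (l \<bullet> gr i l) \<le> G * norm l" by (simp add: mult.commute)
    qed
    finally have "m \<le> dual l + G * norm l" by (simp add: divide_right_mono)
    then show "m \<le> dual ls + G * norm l" using ls_max[of l] lam_nonneg by (simp add: l_def)
    have "(\<Sum>i\<in>UNIV. f i (xs i 1 l)) \<le> (\<Sum>i\<in>(UNIV::'i set). H)"
      using abs_le_D1[OF f_bound[OF xs_in]] by (intro sum_mono) simp
    then show "m \<le> H" using N_pos by (simp add: m_def pos_divide_le_eq mult.commute)
  qed (use N_ge_1 in simp)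
  finally have 2: "real CARD('i) * m \<le> dual ls + ((real CARD('i) - 1) * H + G * norm l)" by simp
  have "((\<Sum>t<T-1. f (s t) (xs (s t) 1 (lam \<alpha> s t))) + real CARD('i) * m) / real T - dual ls
      = ((\<Sum>t<T-1. f (s t) (xs (s t) 1 (lam \<alpha> s t)) - dual ls) + (real CARD('i) * m - dual ls)) / real T"
    using assms by (simp add: sum_subtractf field_simps of_nat_diff)
  also have "\<dots> \<le> ((\<Sum>t<T-1. f (s t) (xs (s t) 1 (lam \<alpha> s t)) - dual ls)
      + ((real CARD('i) - 1) * H + G * norm l)) / real T"
    using 2 by (intro divide_right_mono add_left_mono) auto
  finally show ?thesis using 1 by (simp add: l_def add_divide_distrib)
qed

lemma start_infeas_le:
  assumes "1 \<le> T" "0 < \<alpha>"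
  shows "start_infeas \<alpha> T s \<le> norm (lam \<alpha> s (T - 1)) / (\<alpha> * real T) + G * real CARD('i) / real T
     + G * imbalance T s"
proof -
  define U where "U i = (\<Sum>t\<in>picks T s i. gr i (lam \<alpha> s t))" for i
  define w where "w i = 1 / real CARD('i) - visits T s i / real T" for i
  define l where "l = lam \<alpha> s (T - 1)"
  define y1 y2 where "y1 = (1 / real T) *\<^sub>R (\<Sum>i\<in>UNIV. gr i l)"
    and "y2 = (\<Sum>i\<in>UNIV. (w i / visits T s i) *\<^sub>R U i)"
  have U: "norm (U i) \<le> visits T s i * G" for i
  proof -
    have "norm (U i) \<le> (\<Sum>t\<in>picks T s i. G)"
      unfolding U_def by (intro order.trans[OF norm_sum] sum_mono norm_gr_le)
    then show ?thesis by (simp add: card_picks)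
  qed
  have "(\<Sum>i\<in>UNIV. (1 / (real CARD('i) * visits T s i)) *\<^sub>R U i) = (1 / real T) *\<^sub>R (\<Sum>i\<in>UNIV. U i) + y2"
    unfolding weight_split[OF assms(1)] y2_def w_def
    by (simp only: scaleR_add_left sum.distrib scaleR_sum_right)
  also have "(\<Sum>i\<in>UNIV. U i) = (\<Sum>t<T-1. gr (s t) (lam \<alpha> s t)) + (\<Sum>i\<in>UNIV. gr i l)"
    unfolding U_def sum_picks l_def ..
  also have "(1 / real T) *\<^sub>R \<dots> = (1 / (\<alpha> * real T)) *\<^sub>R (\<alpha> *\<^sub>R (\<Sum>t<T-1. gr (s t) (lam \<alpha> s t))) + y1"
    using assms(2) by (simp add: y1_def scaleR_add_right)
  \<comment> \<open>The trajectory part is replaced by the last multiplier while still inside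
    \<open>plus_norm\<close>, since the replacement is only a componentwise inequality.\<close>
  also have "\<dots> + y2 \<le> (1 / (\<alpha> * real T)) *\<^sub>R l + y1 + y2"
    unfolding l_def using assms(2) sum_gr_le_lam[of \<alpha> s "T - 1"]
    by (intro add_right_mono scaleR_left_mono) auto
  finally have "start_infeas \<alpha> T s \<le> norm ((1 / (\<alpha> * real T)) *\<^sub>R l + y1 + y2)"
    unfolding start_infeas_eq U_def by (rule plus_norm_le_norm)
  also have "\<dots> \<le> norm ((1 / (\<alpha> * real T)) *\<^sub>R l) + norm y1 + norm y2"
    by (intro norm_triangle_le add_mono order_refl norm_triangle_ineq)
  also have "norm ((1 / (\<alpha> * real T)) *\<^sub>R l) = norm l / (\<alpha> * real T)"
    using assms(2) by (simp add: abs_mult)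
  also have "norm y1 \<le> G * real CARD('i) / real T"
  proof -
    have "norm (\<Sum>i\<in>UNIV. gr i l) \<le> (\<Sum>i\<in>(UNIV::'i set). G)"
      by (intro order.trans[OF norm_sum] sum_mono norm_gr_le)
    then show ?thesis by (simp add: y1_def divide_right_mono mult.commute)
  qed
  also have "norm y2 \<le> (\<Sum>i\<in>UNIV. \<bar>w i\<bar> * G)"
    unfolding y2_def
  proof (intro order.trans[OF norm_sum] sum_mono)
    fix i
    have "norm ((w i / visits T s i) *\<^sub>R U i) = \<bar>w i\<bar> * (norm (U i) / visits T s i)"
      using visits_pos[of T s i] by (simp add: abs_divide)
    also have "\<dots> \<le> \<bar>w i\<bar> * G"
      using U[of i] visits_pos[of T s i] by (intro mult_left_mono) (auto simp: pos_divide_le_eq mult.commute)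
    finally show "norm ((w i / visits T s i) *\<^sub>R U i) \<le> \<bar>w i\<bar> * G" .
  qed
  also have "(\<Sum>i\<in>UNIV. \<bar>w i\<bar> * G) = G * imbalance T s"
    by (simp add: imbalance_def w_def sum_distrib_left mult.commute)
  finally show ?thesis by (simp add: l_def)
qed

text \<open>The bias of a block is \<open>1 - 1 / N\<close>. With \<open>N \<le> T\<close> its
  square is absorbed into the variance at the cost of a factor 2; the \<open>N\<close> equal root
  bounds then cancel the \<open>1 / N\<close> in each of them.\<close>

lemma expectation_imbalance:
  assumes "CARD('i) \<le> T"
  shows "measure_pmf.expectation (unif_seq (T - 1)) (imbalance T)
      \<le> sqrt 2 * sqrt ((real CARD('i) - 1) / real T)"
proof -
  define N where "N = real CARD('i)"
  define n where "n = T - 1"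
  have N: "1 \<le> N" "N \<le> real T" using N_ge_1 assms by (auto simp: N_def)
  have T: "real T = real n + 1" using N by (simp add: n_def of_nat_diff)
  define Y where "Y i s = \<bar>1 / N - visits T s i / real T\<bar>" for i s
  have Y: "measure_pmf.expectation (unif_seq n) (Y i) \<le> sqrt (2 * (N - 1) / (real T * N\<^sup>2))" for i
  proof (rule expectation_le_sqrt)
    have "(Y i s)\<^sup>2
        = (1 / (real T)\<^sup>2) * (real (card {t. t < n \<and> s t = i}) - real n / N + (1 - 1 / N))\<^sup>2" for s
    proof -
      have "1 / N - visits T s i / real T
          = - ((1 / real T) * (real (card {t. t < n \<and> s t = i}) - real n / N + (1 - 1 / N)))"
      proof -
        have "real (card {t. t < n \<and> s t = i}) - real n / N + (1 - 1 / N) = visits T s i - real T / N"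
          unfolding T by (simp add: visits_def n_def add_divide_distrib)
        then show ?thesis using N by (simp add: diff_divide_distrib)
      qed
      then show ?thesis unfolding Y_def by (simp add: power_divide)
    qed
    then have "measure_pmf.expectation (unif_seq n) (\<lambda>s. (Y i s)\<^sup>2)
        = (1 / (real T)\<^sup>2) * measure_pmf.expectation (unif_seq n)
          (\<lambda>s. (real (card {t. t < n \<and> s t = i}) - real n / N + (1 - 1 / N))\<^sup>2)"
      by simp
    also have "\<dots> \<le> (1 / (real T)\<^sup>2) * ((1 - 1 / N)\<^sup>2 + real n * (N - 1) / N\<^sup>2)"
      unfolding N_def by (intro mult_left_mono expectation_count_square) simp
    also have "\<dots> \<le> (1 / (real T)\<^sup>2) * ((N - 1) * (2 * real T) / N\<^sup>2)"
    proof (intro mult_left_mono)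
      have "(1 - 1 / N)\<^sup>2 + real n * (N - 1) / N\<^sup>2 = (N - 1) * (N - 1 + real n) / N\<^sup>2"
        using N by (simp add: field_simps power2_eq_square)
      also have "\<dots> \<le> (N - 1) * (2 * real T) / N\<^sup>2"
        using N T by (intro divide_right_mono mult_left_mono) auto
      finally show "(1 - 1 / N)\<^sup>2 + real n * (N - 1) / N\<^sup>2 \<le> (N - 1) * (2 * real T) / N\<^sup>2" .
    qed simp
    also have "\<dots> = 2 * (N - 1) / (real T * N\<^sup>2)"
      by (simp add: power2_eq_square)
    finally show "measure_pmf.expectation (unif_seq n) (\<lambda>s. (Y i s)\<^sup>2) \<le> 2 * (N - 1) / (real T * N\<^sup>2)" .
  qed simp
  have "measure_pmf.expectation (unif_seq n) (imbalance T) = (\<Sum>i\<in>UNIV. measure_pmf.expectation (unif_seq n) (Y i))"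
    unfolding imbalance_def[abs_def] Y_def[abs_def] N_def by (intro Bochner_Integration.integral_sum) simp
  also have "\<dots> \<le> (\<Sum>i\<in>(UNIV::'i set). sqrt (2 * (N - 1) / (real T * N\<^sup>2)))"
    by (intro sum_mono Y)
  also have "\<dots> = N * sqrt (2 * ((N - 1) / real T) / N\<^sup>2)" by (simp add: N_def)
  also have "\<dots> = sqrt 2 * sqrt ((N - 1) / real T)"
    using N by (simp only: real_sqrt_divide[of "2 * ((N - 1) / real T)"] real_sqrt_mult[of 2]) simp
  finally show ?thesis by (simp add: n_def N_def)
qed

text \<open>The root of the merit is at most the sum of its legs. The objective leg is a positive
  part; adding \<open>norm ls\<close> times the violation makes its argument nonnegative by weak
  duality, and the constraint leg supplies the remaining \<open>+ 1\<close>.\<close>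

lemma start_excess_le:
  assumes "dv \<le> dual ls"
  shows "max (sqrt (merit dv (fw_init f A (start \<alpha> T s))) - (dual ls - dv)) 0
    \<le> start_subopt \<alpha> T s + (norm ls + 1) * start_infeas \<alpha> T s"
proof -
  define a where "a = max (start_subopt \<alpha> T s + (dual ls - dv)) 0"
  have "merit dv (fw_init f A (start \<alpha> T s)) = a\<^sup>2 + (start_infeas \<alpha> T s)\<^sup>2"
    by (simp add: merit_def fw_init_def a_def start_subopt_def start_infeas_def
        sum_divide_distrib scaleR_sum_right)
  then have "sqrt (merit dv (fw_init f A (start \<alpha> T s))) \<le> a + start_infeas \<alpha> T s"
    by (simp add: sqrt_sum_squares_le_sum a_def start_infeas_nonneg)
  moreover have nonneg: "0 \<le> start_subopt \<alpha> T s + norm ls * start_infeas \<alpha> T s"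
    using ls_le_objective[of "start \<alpha> T s", OF start_in] by (simp add: start_subopt_def start_infeas_def)
  moreover have "a \<le> start_subopt \<alpha> T s + norm ls * start_infeas \<alpha> T s + (dual ls - dv)"
    unfolding a_def using nonneg assms start_infeas_nonneg[of \<alpha> T s] by (intro max.boundedI) auto
  moreover have "(norm ls + 1) * start_infeas \<alpha> T s = norm ls * start_infeas \<alpha> T s + start_infeas \<alpha> T s"
    by (simp add: algebra_simps)
  ultimately show ?thesis
    using start_infeas_nonneg[of \<alpha> T s] by (intro max.boundedI) linarith+
qed

text \<open>The lower bound on the optimal value comes from the zero multiplier:
  \<open>dual ls \<ge> dual 0 \<ge> - H\<close>.\<close>

lemma start_subopt_le_H: "start_subopt \<alpha> T s \<le> 2 * H"
proof -
  have "(\<Sum>i\<in>UNIV. f i (start \<alpha> T s i)) \<le> (\<Sum>i\<in>(UNIV::'i set). H)"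
    using abs_le_D1[OF f_bound[OF start_in]] by (intro sum_mono) simp
  then have "(\<Sum>i\<in>UNIV. f i (start \<alpha> T s i)) / real CARD('i) \<le> H"
    using N_pos by (simp add: pos_divide_le_eq mult.commute)
  moreover have "- H \<le> dual ls"
  proof -
    have "(\<Sum>i\<in>(UNIV::'i set). - H) \<le> (\<Sum>i\<in>UNIV. f i (xs i 1 0))"
      using abs_le_D2[OF f_bound[OF xs_in]] by (intro sum_mono) (simp add: minus_le_iff)
    then have "- H \<le> dual 0" using N_pos by (simp add: dual_eq field_simps)
    then show ?thesis using ls_max[of 0] by simp
  qed
  ultimately show ?thesis by (simp add: start_subopt_def)
qed

lemma start_infeas_le_G: "start_infeas \<alpha> T s \<le> G"
proof -
  have "(1 / real CARD('i)) *\<^sub>R (\<Sum>i\<in>UNIV. A i *v start \<alpha> T s i) - b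
      = (1 / real CARD('i)) *\<^sub>R (\<Sum>i\<in>UNIV. A i *v start \<alpha> T s i - b)"
    by (simp add: sum_subtractf scaleR_diff_right sum_constant_scaleR del: sum_constant)
  then have "start_infeas \<alpha> T s \<le> norm ((1 / real CARD('i)) *\<^sub>R (\<Sum>i\<in>UNIV. A i *v start \<alpha> T s i - b))"
    by (simp only: start_infeas_def plus_norm_le_norm order_refl)
  also have "\<dots> \<le> (1 / real CARD('i)) * (\<Sum>i\<in>(UNIV::'i set). G)"
    unfolding norm_scaleR
    by (intro mult_mono order.trans[OF norm_sum] sum_mono g_bound start_in) auto
  finally show ?thesis by simp
qed

text \<open>The three summands \<open>C\<close>, \<open>B\<close>, \<open>W\<close> are the terms of
  P3, P4, P5 multiplied by \<open>sqrt 2\<close>. The factor \<open>2 * sqrt 2\<close> is what the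
  damping of stage 2 leaves available.\<close>

lemma expectation_start_excess:
  assumes "1 \<le> T" "0 < G" "0 < L"
  defines "\<alpha> \<equiv> L / (G * sqrt (real T))" and "n \<equiv> norm ls"
  shows "measure_pmf.expectation (unif_seq (T - 1))
      (\<lambda>s. start_subopt \<alpha> T s + (n + 1) * start_infeas \<alpha> T s)
    \<le> 2 * sqrt 2 * ((H + (n + 1) * G) * sqrt ((real CARD('i) - 1) / real T)
      + G * (L + n\<^sup>2 / (2 * L) + (n + 1) * (1 + 2 * n / L)) / sqrt (real T)
      + G * (3 * n + 1 + L) * (real CARD('i) / real T))"
proof -
  define N where "N = real CARD('i)"
  define q u v where "q = sqrt ((N - 1) / real T)" and "u = 1 / sqrt (real T)" and "v = N / real T"
  have N: "1 \<le> N" using N_ge_1 by (simp add: N_def)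
  have T: "1 \<le> real T" using assms(1) by simp
  have n: "0 \<le> n" by (simp add: n_def)
  have uv: "0 \<le> q" "0 \<le> u" "0 \<le> v" using N by (auto simp: q_def u_def v_def)
  have \<alpha>: "0 < \<alpha>" using assms T by (simp add: \<alpha>_def)
  define C where "C = (H + (n + 1) * G) * q"
  define B where "B = G * (L + n\<^sup>2 / (2 * L) + (n + 1) * (1 + 2 * n / L)) * u"
  define W where "W = G * (3 * n + 1 + L) * v"
  have CBW: "0 \<le> C" "0 \<le> B" "0 \<le> W"
    using n assms(2,3) H_nonneg uv by (auto simp: C_def B_def W_def)
  have sqrt2: "1 \<le> sqrt (2::real)" "1 \<le> 2 * sqrt (2::real)"
    using real_sqrt_ge_1_iff[of 2] by linarith+
  have "measure_pmf.expectation (unif_seq (T - 1)) (\<lambda>s. start_subopt \<alpha> T s + (n + 1) * start_infeas \<alpha> T s)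
    \<le> 2 * sqrt 2 * (C + B + W)"
  proof (cases "CARD('i) \<le> T")
    case True
    define m where "m = T - 1"
    define S where "S s = (\<Sum>t<m. f (s t) (xs (s t) 1 (lam \<alpha> s t)) - dual ls)" for s
    define c where "c = G / real T + (n + 1) / (\<alpha> * real T)"
    define k where "k = ((N - 1) * H + (n + 1) * G * N) / real T"
    have c: "0 \<le> c" using n \<alpha> assms(2) by (simp add: c_def)
    have "start_subopt \<alpha> T s + (n + 1) * start_infeas \<alpha> T s
        \<le> S s / real T + k + c * norm (lam \<alpha> s m) + (H + (n + 1) * G) * imbalance T s" for s
    proof -
      have "start_subopt \<alpha> T s + (n + 1) * start_infeas \<alpha> T s
          \<le> (S s / real T + ((N - 1) * H + G * norm (lam \<alpha> s m)) / real T + H * imbalance T s)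
            + (n + 1) * (norm (lam \<alpha> s m) / (\<alpha> * real T) + G * N / real T + G * imbalance T s)"
        unfolding S_def m_def N_def using n assms(1) \<alpha>
        by (intro add_mono mult_left_mono start_subopt_le start_infeas_le) auto
      also have "\<dots> = S s / real T + k + c * norm (lam \<alpha> s m) + (H + (n + 1) * G) * imbalance T s"
        by (simp add: k_def c_def algebra_simps add_divide_distrib diff_divide_distrib)
      finally show ?thesis .
    qed
    then have "measure_pmf.expectation (unif_seq m) (\<lambda>s. start_subopt \<alpha> T s + (n + 1) * start_infeas \<alpha> T s)
        \<le> measure_pmf.expectation (unif_seq m)
          (\<lambda>s. S s / real T + k + c * norm (lam \<alpha> s m) + (H + (n + 1) * G) * imbalance T s)"
      by (intro expectation_mono_finite) auto
    also have "\<dots> = measure_pmf.expectation (unif_seq m) S / real T + k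
        + c * measure_pmf.expectation (unif_seq m) (\<lambda>s. norm (lam \<alpha> s m))
        + (H + (n + 1) * G) * measure_pmf.expectation (unif_seq m) (imbalance T)"
      by simp
    also have "\<dots> \<le> G * L / 2 * u + k + c * (2 * n + L) + (H + (n + 1) * G) * (sqrt 2 * q)"
    proof (intro add_mono mult_left_mono order_refl)
      have m: "real m \<le> real T" by (simp add: m_def)
      have "measure_pmf.expectation (unif_seq m) S \<le> real m * (\<alpha> * G\<^sup>2 / 2)"
        unfolding S_def[abs_def] by (rule expectation_objective[OF \<alpha>])
      also have "\<dots> \<le> real T * (\<alpha> * G\<^sup>2 / 2)"
        using m \<alpha> by (intro mult_right_mono) auto
      finally have "measure_pmf.expectation (unif_seq m) S / real T \<le> \<alpha> * G\<^sup>2 / 2"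
        using T by (simp add: pos_divide_le_eq mult.commute)
      also have "\<dots> = G * L / 2 * u" using assms(2) by (simp add: \<alpha>_def u_def power2_eq_square mult.commute)
      finally show "measure_pmf.expectation (unif_seq m) S / real T \<le> G * L / 2 * u" .
      have "measure_pmf.expectation (unif_seq m) (\<lambda>s. norm (lam \<alpha> s m)) \<le> 2 * n + sqrt (real m) * \<alpha> * G"
        unfolding n_def using \<alpha> by (intro expectation_norm_lam) simp
      also have "sqrt (real m) * \<alpha> * G \<le> sqrt (real T) * \<alpha> * G"
        using m \<alpha> assms(2) by (intro mult_right_mono) auto
      also have "\<dots> = L" using T assms(2) by (simp add: \<alpha>_def)
      finally show "measure_pmf.expectation (unif_seq m) (\<lambda>s. norm (lam \<alpha> s m)) \<le> 2 * n + L" by simp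
      show "measure_pmf.expectation (unif_seq m) (imbalance T) \<le> sqrt 2 * q"
        unfolding m_def q_def N_def by (rule expectation_imbalance[OF True])
    qed (use c n H_nonneg assms(2) in auto)
    also have "\<dots> \<le> 2 * sqrt 2 * (C + B + W)"
    proof -
      \<comment> \<open>A number in the unit interval is at most its root. This moves the surplus
        evaluations of the last pass, of order \<open>(N - 1) / T\<close>, into the term with
        \<open>H\<close>.\<close>
      have "(N - 1) / real T \<le> q"
      proof -
        have "(N - 1) / real T \<le> 1" "0 \<le> (N - 1) / real T" using True T N by (auto simp: N_def)
        then have "((N - 1) / real T)\<^sup>2 \<le> (N - 1) / real T"
          unfolding power2_eq_square by (rule mult_left_le)
        then show ?thesis unfolding q_def by (rule real_le_rsqrt)
      qed
      then have "(N - 1) / real T * H \<le> q * H" using H_nonneg by (rule mult_right_mono)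
      then have k: "k \<le> q * H + (n + 1) * G * v"
        by (simp add: k_def v_def add_divide_distrib)
      have "1 / (\<alpha> * real T) = G / L * u"
      proof -
        have "sqrt (real T) * sqrt (real T) = real T" by simp
        then have "\<alpha> * real T = L / G * sqrt (real T)"
          using T assms(2) unfolding \<alpha>_def by (simp add: field_simps)
        then show ?thesis by (simp add: u_def)
      qed
      then have "c = G / real T + (n + 1) * (G / L * u)"
        by (simp add: c_def divide_inverse)
      moreover have "G / real T \<le> G * v"
        using N assms(2) by (simp add: v_def divide_right_mono)
      ultimately have "c \<le> G * v + (n + 1) * (G / L * u)" by simp
      then have "c * (2 * n + L) \<le> (G * v + (n + 1) * (G / L * u)) * (2 * n + L)"
        using n assms(3) by (intro mult_right_mono) auto
      also have "\<dots> = G * v * (2 * n + L) + G * ((n + 1) * (1 + 2 * n / L)) * u"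
        using assms(3) by (simp add: field_simps)
      finally have c: "c * (2 * n + L) \<le> \<dots>" .
      have "G * L / 2 * u + G * ((n + 1) * (1 + 2 * n / L)) * u \<le> B"
      proof -
        have "G * (L / 2 + (n + 1) * (1 + 2 * n / L)) * u \<le> B"
          unfolding B_def using n assms(2,3) uv by (intro mult_right_mono mult_left_mono add_mono) auto
        then show ?thesis by (simp add: algebra_simps)
      qed
      moreover have "(n + 1) * G * v + G * v * (2 * n + L) = W" by (simp add: W_def algebra_simps)
      moreover have "q * H + (H + (n + 1) * G) * (sqrt 2 * q) \<le> C + sqrt 2 * C"
      proof -
        have "q * H \<le> C" using n assms(2) uv by (simp add: C_def algebra_simps)
        then show ?thesis by (simp add: C_def mult_ac)
      qed
      ultimately have "G * L / 2 * u + k + c * (2 * n + L) + (H + (n + 1) * G) * (sqrt 2 * q)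
          \<le> (1 + sqrt 2) * C + B + W"
        using k c by (simp add: algebra_simps)
      also have "\<dots> \<le> 2 * sqrt 2 * C + 2 * sqrt 2 * B + 2 * sqrt 2 * W"
      proof (intro add_mono)
        show "(1 + sqrt 2) * C \<le> 2 * sqrt 2 * C" using CBW sqrt2 by (intro mult_right_mono) auto
        show "B \<le> 2 * sqrt 2 * B" "W \<le> 2 * sqrt 2 * W"
          using CBW mult_right_mono[of 1 "2 * sqrt 2"] sqrt2 by simp_all
      qed
      finally show ?thesis by (simp add: algebra_simps)
    qed
    finally show ?thesis by (simp add: m_def)
  next
    case False
    \<comment> \<open>Strictness of \<open>T < N\<close> is what gives
      \<open>(N - 1) / T \<ge> 1\<close>; then \<open>C\<close> alone dominates
      \<open>H + (n + 1) * G\<close>.\<close>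
    then have "real T + 1 \<le> N" by (simp add: N_def)
    then have "1 \<le> q" using T by (simp add: q_def)
    have "measure_pmf.expectation (unif_seq (T - 1)) (\<lambda>s. start_subopt \<alpha> T s + (n + 1) * start_infeas \<alpha> T s)
        \<le> measure_pmf.expectation (unif_seq (T - 1)) (\<lambda>_::nat \<Rightarrow> 'i. 2 * H + (n + 1) * G)"
      using n by (intro expectation_mono_finite add_mono mult_left_mono start_subopt_le_H start_infeas_le_G) auto
    also have "\<dots> = 2 * H + (n + 1) * G" by simp
    also have "\<dots> \<le> 2 * sqrt 2 * (H + (n + 1) * G)"
    proof -
      have "2 * (H + (n + 1) * G) \<le> 2 * sqrt 2 * (H + (n + 1) * G)"
        using H_nonneg n assms(2) by (intro mult_right_mono) auto
      moreover have "0 \<le> (n + 1) * G" using n assms(2) by simp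
      ultimately show ?thesis by simp
    qed
    also have "\<dots> \<le> 2 * sqrt 2 * (C + B + W)"
    proof (intro mult_left_mono)
      have "(H + (n + 1) * G) * 1 \<le> C"
        unfolding C_def using \<open>1 \<le> q\<close> H_nonneg n assms(2) by (intro mult_left_mono) auto
      then show "H + (n + 1) * G \<le> C + B + W" using CBW by simp
    qed simp
    finally show ?thesis .
  qed
  then show ?thesis by (simp add: C_def B_def W_def q_def u_def v_def N_def)
qed

section \<open>Both stages combined\<close>

lemma dual_avg_le: "dual (dual_avg A b xs 0 (\<lambda>_. \<alpha>) T s) \<le> dual ls"
  unfolding dual_avg_def by (intro ls_max scaleR_nonneg_nonneg sum_nonneg lam_nonneg) simp

lemma samples_eq: "samples T K = pair_pmf (unif_seq (T - 1)) (unif_seq K)"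
  by (simp add: samples_def unif_seq_def)

text \<open>For fixed stage 1 indices the bound of stage 2 is affine in the dual gap and the initial
  excess, so the outer expectation acts on these two quantities separately.\<close>

lemma expectation_merit_le_rate:
  assumes "1 \<le> T" "1 \<le> K" "0 < G" "0 < L"
  defines "\<alpha> \<equiv> L / (G * sqrt (real T))"
    and "\<rho> \<equiv> \<lambda>k. 2 * real CARD('i) / (real k + 2 * real CARD('i))"
  shows "measure_pmf.expectation (samples T K)
      (\<lambda>(s, r). sqrt (merit (dual (dual_avg A b xs 0 (\<lambda>_. \<alpha>) T s))
        (fw_iter f A b xs (dual (dual_avg A b xs 0 (\<lambda>_. \<alpha>) T s)) \<rho> (start \<alpha> T s) r K)))
    \<le> rate CARD('i) G H D L (norm ls) T K"
proof -
  define n where "n = norm ls"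
  define dv where "dv s = dual (dual_avg A b xs 0 (\<lambda>_. \<alpha>) T s)" for s
  define e where "e s = start_subopt \<alpha> T s + (n + 1) * start_infeas \<alpha> T s" for s
  define Q where "Q = (H + (n + 1) * G) * sqrt ((real CARD('i) - 1) / real T)
      + G * (L + n\<^sup>2 / (2 * L) + (n + 1) * (1 + 2 * n / L)) / sqrt (real T)
      + G * (3 * n + 1 + L) * (real CARD('i) / real T)"
  have \<alpha>: "0 < \<alpha>" using assms by (simp add: \<alpha>_def)
  have dv: "dv s \<le> dual ls" for s
    unfolding dv_def by (rule dual_avg_le)
  have "measure_pmf.expectation (unif_seq K) (\<lambda>r. sqrt (merit (dv s) (fw_iter f A b xs (dv s) \<rho> (start \<alpha> T s) r K)))
      \<le> (dual ls - dv s) + real CARD('i) / (2 * real K) * e s + 2 * D / sqrt (real K)" for s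
  proof -
    have "real CARD('i) / (2 * real K) * max (sqrt (merit (dv s) (fw_init f A (start \<alpha> T s))) - (dual ls - dv s)) 0
        \<le> real CARD('i) / (2 * real K) * e s"
      unfolding e_def n_def by (intro mult_left_mono start_excess_le dv) simp
    then show ?thesis
      using stage2_bound[of "start \<alpha> T s" "dv s" K, OF start_in dv assms(2)] unfolding \<rho>_def by linarith
  qed
  then have "measure_pmf.expectation (samples T K)
      (\<lambda>(s, r). sqrt (merit (dv s) (fw_iter f A b xs (dv s) \<rho> (start \<alpha> T s) r K)))
      \<le> measure_pmf.expectation (unif_seq (T - 1))
        (\<lambda>s. (dual ls - dv s) + real CARD('i) / (2 * real K) * e s + 2 * D / sqrt (real K))"
    unfolding samples_eq expectation_pair_pmf_finite[OF finite_set_unif_seq finite_set_unif_seq] prod.case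
    by (intro expectation_mono_finite) simp_all
  also have "\<dots> = measure_pmf.expectation (unif_seq (T - 1)) (\<lambda>s. dual ls - dv s)
      + real CARD('i) / (2 * real K) * measure_pmf.expectation (unif_seq (T - 1)) e + 2 * D / sqrt (real K)"
    by simp
  also have "\<dots> \<le> (n\<^sup>2 / (2 * \<alpha> * real T) + \<alpha> * G\<^sup>2 / 2)
      + real CARD('i) / (2 * real K) * (2 * sqrt 2 * Q) + 2 * D / sqrt (real K)"
    unfolding dv_def n_def e_def[abs_def] Q_def \<alpha>_def
    by (intro add_mono mult_left_mono order_refl expectation_start_excess expectation_dual_gap)
      (use assms \<alpha> in \<open>simp_all add: \<alpha>_def\<close>)
  also have "n\<^sup>2 / (2 * \<alpha> * real T) + \<alpha> * G\<^sup>2 / 2 = G * (n\<^sup>2 / (2 * L) + L / 2) / sqrt (real T)"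
  proof -
    have "sqrt (real T) * sqrt (real T) = real T" by simp
    then have "\<alpha> * real T = L / G * sqrt (real T)"
      using assms(1,3) unfolding \<alpha>_def by (simp add: field_simps)
    then have "n\<^sup>2 / (2 * \<alpha> * real T) = G * (n\<^sup>2 / (2 * L)) / sqrt (real T)"
      by (simp add: mult.assoc)
    moreover have "\<alpha> * G\<^sup>2 / 2 = G * (L / 2) / sqrt (real T)"
      using assms(3) by (simp add: \<alpha>_def power2_eq_square mult.commute)
    ultimately show ?thesis by (simp add: distrib_left add_divide_distrib)
  qed
  \<comment> \<open>The allowance \<open>2 * sqrt 2\<close> against the damping
    \<open>N / (2 K)\<close> yields the stated factor \<open>2 N / K\<close> with the
    \<open>1 / sqrt 2\<close> found in P3, P4 and P5.\<close>
  also have "real CARD('i) / (2 * real K) * (2 * sqrt 2 * Q) = 2 * real CARD('i) / real K * (Q / sqrt 2)"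
  proof -
    have "sqrt 2 * Q = 2 * (Q / sqrt 2)" by (simp add: field_simps)
    then show ?thesis by (simp add: mult.assoc)
  qed
  also have "Q / sqrt 2 = (H + (n + 1) * G) / sqrt 2 * sqrt ((real CARD('i) - 1) / real T)
      + G * (L / sqrt 2 + n\<^sup>2 / (2 * sqrt 2 * L) + (n + 1) / sqrt 2 * (1 + 2 * n / L)) / sqrt (real T)
      + G * ((3 * n + 1 + L) / sqrt 2) * (real CARD('i) / real T)"
    by (simp add: Q_def add_divide_distrib ring_distribs mult_ac)
  finally show ?thesis
    by (simp add: rate_def Let_def dv_def n_def)
qed

text \<open>Convexity makes \<open>\<beta>\<close> overestimate the objective of the output, and
  \<open>dv \<le> dual ls\<close> makes the target stricter than the optimum; the constraint part is
  exact. Each quantity is thus at most one leg of the merit, which is why one rate serves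
  both.\<close>

lemma output_le_merit:
  assumes "fw_inv st" "dv \<le> dual ls"
  shows "(1 / real CARD('i)) * (\<Sum>i\<in>UNIV. f i (snd (snd st) i)) - dual ls \<le> sqrt (merit dv st)"
    and "plus_norm ((1 / real CARD('i)) *\<^sub>R (\<Sum>i\<in>UNIV. A i *v snd (snd st) i) - b) \<le> sqrt (merit dv st)"
proof -
  obtain \<beta> z x where st: "st = (\<beta>, z, x)" by (cases st)
  have inv: "f i (x i) \<le> real CARD('i) * \<beta> i" "A i *v x i = real CARD('i) *\<^sub>R z i" for i
    using assms(1) unfolding fw_inv_def st by auto
  have "(1 / real CARD('i)) * (\<Sum>i\<in>UNIV. f i (x i)) \<le> (1 / real CARD('i)) * (\<Sum>i\<in>UNIV. real CARD('i) * \<beta> i)"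
    by (intro mult_left_mono sum_mono inv) simp
  also have "\<dots> = (\<Sum>i\<in>UNIV. \<beta> i)" by (simp add: sum_distrib_left[symmetric])
  finally have "(1 / real CARD('i)) * (\<Sum>i\<in>UNIV. f i (x i)) - dual ls \<le> max ((\<Sum>i\<in>UNIV. \<beta> i) - dv) 0"
    using assms(2) by simp
  also have "\<dots> \<le> sqrt (merit dv st)"
    unfolding merit_def st by (intro real_le_rsqrt) simp
  finally show "(1 / real CARD('i)) * (\<Sum>i\<in>UNIV. f i (snd (snd st) i)) - dual ls \<le> sqrt (merit dv st)"
    by (simp add: st)
  have "(1 / real CARD('i)) *\<^sub>R (\<Sum>i\<in>UNIV. A i *v x i) = (\<Sum>i\<in>UNIV. z i)"
    by (simp add: inv(2) scaleR_sum_right[symmetric])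
  then show "plus_norm ((1 / real CARD('i)) *\<^sub>R (\<Sum>i\<in>UNIV. A i *v snd (snd st) i) - b) \<le> sqrt (merit dv st)"
    unfolding merit_def st by (intro real_le_rsqrt) simp
qed

theorem two_stage_rate:
  fixes T K :: nat and L :: real
  assumes "1 \<le> T" "1 \<le> K" "0 < G" "0 < L"
  defines "out \<equiv> two_stage_output X f A b xs 0 (\<lambda>t. L / (G * sqrt (real T)))
    (\<lambda>k. 2 * real CARD('i) / (real k + 2 * real CARD('i))) T K"
  shows "measure_pmf.expectation (samples T K)
      (\<lambda>\<omega>. (1 / real CARD('i)) * (\<Sum>i\<in>UNIV. f i (out \<omega> i)) - dual ls)
      \<le> rate CARD('i) G H D L (norm ls) T K"
    and "measure_pmf.expectation (samples T K)
      (\<lambda>\<omega>. plus_norm ((1 / real CARD('i)) *\<^sub>R (\<Sum>i\<in>UNIV. A i *v out \<omega> i) - b))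
      \<le> rate CARD('i) G H D L (norm ls) T K"
proof -
  define \<alpha> where "\<alpha> = L / (G * sqrt (real T))"
  define \<rho> where "\<rho> = (\<lambda>k::nat. 2 * real CARD('i) / (real k + 2 * real CARD('i)))"
  define dv where "dv s = dual (dual_avg A b xs 0 (\<lambda>_. \<alpha>) T s)" for s
  define st where "st s r = fw_iter f A b xs (dv s) \<rho> (start \<alpha> T s) r K" for s r
  have out: "out (s, r) = snd (snd (st s r))" for s r
    by (simp add: out_def two_stage_output_def st_def dv_def \<alpha>_def \<rho>_def)
  have \<rho>: "0 \<le> \<rho> k" "\<rho> k \<le> 1" for k
    using N_pos by (auto simp: \<rho>_def divide_le_eq intro!: add_nonneg_pos)
  have inv: "fw_inv (st s r)" for s r
    unfolding st_def by (intro fw_inv_iter start_in \<rho>)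
  have dv: "dv s \<le> dual ls" for s
    unfolding dv_def by (rule dual_avg_le)
  have fin: "finite (set_pmf (samples T K :: ((nat \<Rightarrow> 'i) \<times> (nat \<Rightarrow> 'i)) pmf))"
    by (simp add: samples_eq)
  have rate: "measure_pmf.expectation (samples T K) (\<lambda>(s, r). sqrt (merit (dv s) (st s r)))
      \<le> rate CARD('i) G H D L (norm ls) T K"
    using expectation_merit_le_rate[OF assms(1-4)] by (simp add: st_def dv_def \<alpha>_def \<rho>_def)
  show "measure_pmf.expectation (samples T K)
      (\<lambda>\<omega>. (1 / real CARD('i)) * (\<Sum>i\<in>UNIV. f i (out \<omega> i)) - dual ls)
      \<le> rate CARD('i) G H D L (norm ls) T K"
    using output_le_merit(1)[OF inv dv]
    by (intro order.trans[OF expectation_mono_finite[OF fin] rate]) (auto simp: out split: prod.split)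
  show "measure_pmf.expectation (samples T K)
      (\<lambda>\<omega>. plus_norm ((1 / real CARD('i)) *\<^sub>R (\<Sum>i\<in>UNIV. A i *v out \<omega> i) - b))
      \<le> rate CARD('i) G H D L (norm ls) T K"
    using output_le_merit(2)[OF inv dv]
    by (intro order.trans[OF expectation_mono_finite[OF fin] rate]) (auto simp: out split: prod.split)
qed

end

subsection \<open>Extended-real-valued objectives\<close>

lemma proper_on_eff_dom_real:
  assumes "proper_on S h" "x \<in> eff_dom S h"
  shows "h x = ereal (real_of_ereal (h x))"
  using assms by (cases "h x") (auto simp: proper_on_def eff_dom_def)

lemma convex_on_eff_dom:
  assumes "proper_on S h" "ereal_convex_on S h" "convex (eff_dom S h)"
  shows "convex_on (eff_dom S h) (\<lambda>x. real_of_ereal (h x))"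
proof (rule convex_onI)
  fix t :: real and x y
  assume t: "0 < t" "t < 1" and xy: "x \<in> eff_dom S h" "y \<in> eff_dom S h"
  let ?z = "(1 - t) *\<^sub>R x + t *\<^sub>R y"
  have z: "?z \<in> eff_dom S h" using t xy by (intro convexD[OF assms(3)]) auto
  have "h ?z \<le> ereal (1 - t) * h x + ereal t * h y"
    using assms(2) t xy by (auto simp: ereal_convex_on_def eff_dom_def)
  then have "ereal (real_of_ereal (h ?z))
      \<le> ereal (1 - t) * ereal (real_of_ereal (h x)) + ereal t * ereal (real_of_ereal (h y))"
    using proper_on_eff_dom_real[OF assms(1)] xy z by metis
  then show "real_of_ereal (h ?z) \<le> (1 - t) * real_of_ereal (h x) + t * real_of_ereal (h y)"
    by simp
qed (rule assms(3))

text \<open>The infimum equals a real number, so it lies strictly below \<open>v + e\<close>; in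
  particular the feasible set cannot be empty, as its infimum would be infinite.\<close>

lemma near_optimal_primal:
  fixes X :: "'i::finite \<Rightarrow> (real^'d) set" and A :: "'i \<Rightarrow> real^'d^'m"
  assumes "ereal v = primal_value X h A b" "0 < e"
    and h: "\<And>i x. x \<in> X i \<Longrightarrow> h i x = ereal (f i x)"
  shows "\<exists>x. (\<forall>i. x i \<in> X i) \<and> (1 / real CARD('i)) *\<^sub>R (\<Sum>i\<in>UNIV. A i *v x i) \<le> b
    \<and> (1 / real CARD('i)) * (\<Sum>i\<in>UNIV. f i (x i)) < v + e"
proof -
  have "primal_value X h A b < ereal (v + e)" using assms(1,2) by (simp flip: assms(1))
  then obtain x where x: "\<And>i. x i \<in> X i" "(1 / real CARD('i)) *\<^sub>R (\<Sum>i\<in>UNIV. A i *v x i) \<le> b"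
      "ereal (1 / real CARD('i)) * (\<Sum>i\<in>UNIV. h i (x i)) < ereal (v + e)"
    unfolding primal_value_def INF_less_iff by blast
  have "(1 / real CARD('i)) * (\<Sum>i\<in>UNIV. f i (x i)) < v + e"
    using x(3) by (simp add: h[OF x(1)])
  with x show ?thesis by blast
qed

lemma bdd_above_G_const:
  fixes X :: "'i::finite \<Rightarrow> (real^'d) set" and A :: "'i \<Rightarrow> real^'d^'m"
  assumes "\<And>i. compact (X i)"
  shows "bdd_above {norm (A i *v x - b) | i x. x \<in> X i}"
proof -
  have "{norm (A i *v x - b) | i x. x \<in> X i} = (\<Union>i\<in>UNIV. (\<lambda>x. norm (A i *v x - b)) ` X i)" by auto
  moreover have "compact ((\<lambda>x. norm (A i *v x - b)) ` X i)" for i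
    by (intro compact_continuous_image assms continuous_intros matrix_vector_mult_linear_continuous_on)
  ultimately show ?thesis
    by (simp add: bdd_above_UN bounded_imp_bdd_above compact_imp_bounded)
qed

theorem theorem3p3:
  fixes J :: "'i::finite \<Rightarrow> 'd::finite set"
    and h :: "'i \<Rightarrow> real^'d \<Rightarrow> ereal"
    and A :: "'i \<Rightarrow> real^'d^'m"
    and b :: "real^'m"
    and X :: "'i \<Rightarrow> (real^'d) set"
    and f :: "'i \<Rightarrow> real^'d \<Rightarrow> real"
    and xs :: "'i \<Rightarrow> real \<Rightarrow> real^'m \<Rightarrow> real^'d"
    and ls :: "real^'m"
    and N T K :: nat
    and G H D L dstar :: real
    and out :: "(nat \<Rightarrow> 'i) \<times> (nat \<Rightarrow> 'i) \<Rightarrow> 'i \<Rightarrow> real^'d"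
  assumes N: "N = CARD('i)"
    and X: "\<And>i. X i = eff_dom (coord_space (J i)) (h i)"
    and f: "\<And>i x. f i x = real_of_ereal (h i x)"
    and proper: "\<And>i. proper_on (coord_space (J i)) (h i)"
    and conv: "\<And>i. ereal_convex_on (coord_space (J i)) (h i)"
    and lsc: "\<And>i. lsc_on (coord_space (J i)) (h i)"
    and dom: "\<And>i. convex (X i)" "\<And>i. compact (X i)"
    and H_finite: "bdd_above {\<bar>f i x\<bar> | i x. x \<in> X i}"
    and G: "G = G_const X A b" "G > 0"
    and H: "H = H_const X f"
    and D: "D = D_const X f A"
    and lmo: "is_oracle X f A xs"
    and dual_max: "0 \<le> ls" "\<And>l. 0 \<le> l \<Longrightarrow> dual_fun X f A b l \<le> dual_fun X f A b ls"
    and dstar: "dstar = dual_fun X f A b ls"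
    and strong_duality: "ereal dstar = primal_value X h A b"
    and L: "L > 0"
    and T: "T \<ge> 1"
    and K: "K \<ge> 1"
    and out: "out = two_stage_output X f A b xs 0 (\<lambda>t. L / (G * sqrt (real T)))
                   (\<lambda>k. 2 * real N / (real k + 2 * real N)) T K"
  shows "measure_pmf.expectation (samples T K)
           (\<lambda>\<omega>. (1 / real N) * (\<Sum>i\<in>UNIV. f i (out \<omega> i)) - dstar)
         \<le> rate N G H D L (norm ls) T K
       \<and> measure_pmf.expectation (samples T K)
           (\<lambda>\<omega>. plus_norm ((1 / real N) *\<^sub>R (\<Sum>i\<in>UNIV. A i *v out \<omega> i) - b))
         \<le> rate N G H D L (norm ls) T K"
proof -
  interpret dual_decomposition X f A b ls xs H G
  proof
    have hf: "h i x = ereal (f i x)" if "x \<in> X i" for i x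
      using proper_on_eff_dom_real[OF proper] that by (simp add: X f)
    show "X i \<noteq> {}" for i
      using proper[of i] by (auto simp: X eff_dom_def proper_on_def)
    show "convex (X i)" for i by (rule dom(1))
    show "convex_on (X i) (f i)" for i
    proof -
      have "f i = (\<lambda>x. real_of_ereal (h i x))" by (simp add: f fun_eq_iff)
      then show ?thesis
        using convex_on_eff_dom[OF proper conv, of i] dom(1)[of i] by (simp add: X)
    qed
    \<comment> \<open>A real supremum is an upper bound only for a set that is bounded above: for
      \<open>H\<close> this is assumed, for \<open>G\<close> it follows from compactness of the
      domains.\<close>
    show "\<bar>f i x\<bar> \<le> H" if "x \<in> X i" for i x
      unfolding H H_const_def using that by (intro cSup_upper H_finite) auto
    show "norm (A i *v x - b) \<le> G" if "x \<in> X i" for i x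
      unfolding G(1) G_const_def using that by (intro cSup_upper bdd_above_G_const dom(2)) auto
    show "is_oracle X f A xs" by (rule lmo)
    show "0 \<le> ls" by (rule dual_max(1))
    show "dual_fun X f A b l \<le> dual_fun X f A b ls" if "0 \<le> l" for l
      using that by (rule dual_max(2))
    show "\<exists>x. (\<forall>i. x i \<in> X i) \<and> (1 / real CARD('i)) *\<^sub>R (\<Sum>i\<in>UNIV. A i *v x i) \<le> b
        \<and> (1 / real CARD('i)) * (\<Sum>i\<in>UNIV. f i (x i)) < dual_fun X f A b ls + e" if "0 < e" for e
      using near_optimal_primal[OF strong_duality that hf] by (simp add: dstar)
  qed
  show ?thesis
    unfolding out N dstar D using two_stage_rate[OF T K G(2) L] by blast
qed

end
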